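(* There exists a strong completion $\mathcal{A}$ of $\mathcal{K}_1$ of low Turing degree; that is, there exist a low set $Y\subseteq\omega$ and a strong completion $\mathcal{A}$ of $\mathcal{K}_1$ such that $\mathcal{A}$ is $Y$-computable.
   Context: A set $Y\subseteq\omega$ is low if $Y'\leq_T\emptyset'$, where $'$ denotes the Turing jump. A partial applicative structure (pas) is a set $\mathcal{A}$ with a partial binary operation $(a,b)\mapsto a\cdot b=ab$, called application, associating to the left; $ab\downarrow$ means that $ab$ is defined. Application is strict: a compound term $t_1t_2$ is defined only if $t_1$ and $t_2$ are both defined. For closed terms, $t\simeq s$ means that either both are undefined, or both are defined and equal. Elements $k,s\in\mathcal{A}$ serve as combinators for $\mathcal{A}$ if for all $a,b,c\in\mathcal{A}$: $ka\downarrow$ and $kab=a$; $sab\downarrow$ and $sabc\simeq ac(bc)$. A pas is a partial combinatory algebra (pca) if it has such combinators $k,s$. A combinatory algebra is a pca whose application is total. All pcas are assumed nontrivial, i.e. to have more than one element. $\mathcal{K}_1$ (Kleene's first model) is the pca on $\omega$ with application $n\cdot m=\varphi_n(m)$, where $\varphi_n$ is the $n$-th partial computable function. A weak embedding of a pca $\mathcal{A}$ into a pca $\mathcal{B}$ is an injection $f:\mathcal{A}\to\mathcal{B}$ such that for all $a,b\in\mathcal{A}$, if $ab$ is defined in $\mathcal{A}$, then $f(a)f(b)$ is defined in $\mathcal{B}$ and equals $f(ab)$. It is a strong embedding if in addition, for a specific choice of combinators $k,s$ of $\mathcal{A}$, the elements $f(k),f(s)$ serve as combinators for $\mathcal{B}$.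 A strong completion of $\mathcal{A}$ is a (total) combinatory algebra $\mathcal{B}$ for which there is a strong embedding of $\mathcal{A}$ into $\mathcal{B}$. A combinatory algebra $\mathcal{A}$ is $Y$-computable if there are a surjection (numbering) $\gamma:\omega\to\mathcal{A}$ and a total $Y$-computable function $\psi:\omega^2\to\omega$ such that $\gamma(n)\cdot\gamma(m)=\gamma(\psi(n,m))$ for all $n,m$, and such that the set $\{(n,m)\mid\gamma(n)=\gamma(m)\}$ is $Y$-computable. (No effectivity is required of $\gamma$ itself.) *)

theory Defs
  imports Main "HOL-Library.Nat_Bijection"
begin

section \<open>Computability relative to an oracle\<close>

text \<open>
  Programs for the partial functions on the natural numbers that are partial recursive
  in an oracle set. All programs are unary; several arguments are passed through the
  Cantor pairing function \<^const>\<open>prod_encode\<close>.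
\<close>

datatype code =
    Zero | Succ | Fst | Snd | Oracle
  | Pair code code | Comp code code | Prec code code | Mu code

primrec eval :: "nat set \<Rightarrow> code \<Rightarrow> nat \<Rightarrow> nat option" where
  "eval Y Zero = (\<lambda>x. Some 0)"
| "eval Y Succ = (\<lambda>x. Some (Suc x))"
| "eval Y Fst = (\<lambda>x. Some (fst (prod_decode x)))"
| "eval Y Snd = (\<lambda>x. Some (snd (prod_decode x)))"
| "eval Y Oracle = (\<lambda>x. Some (if x \<in> Y then 1 else 0))"
| "eval Y (Pair c d) = (\<lambda>x.
     Option.bind (eval Y c x) (\<lambda>u. Option.bind (eval Y d x) (\<lambda>v. Some (prod_encode (u, v)))))"
| "eval Y (Comp c d) = (\<lambda>x. Option.bind (eval Y d x) (eval Y c))"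
| "eval Y (Prec c d) = (\<lambda>x. case prod_decode x of (a, n) \<Rightarrow>
     rec_nat (eval Y c a)
       (\<lambda>i r. Option.bind r (\<lambda>v. eval Y d (prod_encode (a, prod_encode (i, v))))) n)"
| "eval Y (Mu c) = (\<lambda>a.
     if \<exists>n. eval Y c (prod_encode (a, n)) = Some 0
            \<and> (\<forall>i<n. eval Y c (prod_encode (a, i)) \<noteq> None)
     then Some (LEAST n. eval Y c (prod_encode (a, n)) = Some 0)
     else None)"

text \<open>An effective bijective Goedel numbering of programs.\<close>

primrec encode :: "code \<Rightarrow> nat" where
  "encode Zero = 0"
| "encode Succ = 1"
| "encode Fst = 2"
| "encode Snd = 3"
| "encode Oracle = 4"
| "encode (Pair c d) = 5 + 4 * prod_encode (encode c, encode d)"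
| "encode (Comp c d) = 6 + 4 * prod_encode (encode c, encode d)"
| "encode (Prec c d) = 7 + 4 * prod_encode (encode c, encode d)"
| "encode (Mu c) = 8 + 4 * encode c"

lemma inj_encode: "encode c = encode d \<Longrightarrow> c = d"
proof (induction c arbitrary: d)
  case Zero then show ?case by (cases d) auto
next
  case Succ then show ?case by (cases d) auto
next
  case Fst then show ?case by (cases d) auto
next
  case Snd then show ?case by (cases d) auto
next
  case Oracle then show ?case by (cases d) auto
next
  case (Pair c1 c2) then show ?case by (cases d) (simp_all, presburger+)
next
  case (Comp c1 c2) then show ?case by (cases d) (simp_all, presburger+)
next
  case (Prec c1 c2) then show ?case by (cases d) (simp_all, presburger+)
next
  case (Mu c) then show ?case by (cases d) (simp_all, presburger+)
qed

lemma ex_encode: "\<exists>c. encode c = n"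
proof (induction n rule: less_induct)
  case (less n)
  show ?case
  proof (cases "n < 5")
    case True
    then have "n = 0 \<or> n = 1 \<or> n = 2 \<or> n = 3 \<or> n = 4" by linarith
    then show ?thesis
      using encode.simps(1-5) by metis
  next
    case False
    define q where "q = (n - 5) div 4"
    obtain i j where ij: "q = prod_encode (i, j)"
      by (metis prod_decode_inverse surj_pair)
    have "i \<le> q" "j \<le> q"
      unfolding ij by (rule le_prod_encode_1, rule le_prod_encode_2)
    moreover have "q < n" using False by (simp add: q_def)
    ultimately obtain c d e where
      *: "encode c = i" "encode d = j" "encode e = q"
      using less by (meson le_less_trans)
    have "n = 5 + 4 * q \<or> n = 6 + 4 * q \<or> n = 7 + 4 * q \<or> n = 8 + 4 * q"
      using False unfolding q_def by presburger
    then show ?thesis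
      using * ij encode.simps(6-9) by metis
  qed
qed

lemma bij_encode: "bij encode"
  unfolding bij_def inj_def surj_def using inj_encode ex_encode by metis

definition phi :: "nat set \<Rightarrow> nat \<Rightarrow> nat \<Rightarrow> nat option" where
  "phi Y n = eval Y (inv encode n)"

lemma phi_encode [simp]: "phi Y (encode c) = eval Y c"
  by (simp add: phi_def bij_encode bij_is_inj inv_f_f)

definition computable_in :: "nat set \<Rightarrow> (nat \<Rightarrow> nat) \<Rightarrow> bool" where
  "computable_in Y f \<longleftrightarrow> (\<exists>n. \<forall>x. phi Y n x = Some (f x))"

definition computable2_in :: "nat set \<Rightarrow> (nat \<Rightarrow> nat \<Rightarrow> nat) \<Rightarrow> bool" where
  "computable2_in Y f \<longleftrightarrow> (\<exists>n. \<forall>x y. phi Y n (prod_encode (x, y)) = Some (f x y))"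

definition turing_le :: "nat set \<Rightarrow> nat set \<Rightarrow> bool"  (infix "\<le>\<^sub>T" 50) where
  "X \<le>\<^sub>T Y \<longleftrightarrow> computable_in Y (\<lambda>x. if x \<in> X then 1 else 0)"

definition jump :: "nat set \<Rightarrow> nat set" where
  "jump Y = {n. phi Y n n \<noteq> None}"

definition low :: "nat set \<Rightarrow> bool" where
  "low Y \<longleftrightarrow> jump Y \<le>\<^sub>T jump {}"

section \<open>Partial combinatory algebras\<close>

text \<open>
  The field \<open>app\<close> gives \<^const>\<open>None\<close> for an undefined application. Its values
  outside the carrier are irrelevant.
\<close>

record 'a pas =
  carr :: "'a set"
  app :: "'a \<Rightarrow> 'a \<Rightarrow> 'a option"

definition is_pas :: "'a pas \<Rightarrow> bool" where
  "is_pas A \<longleftrightarrow> (\<forall>a\<in>carr A. \<forall>b\<in>carr A. \<forall>c. app A a b = Some c \<longrightarrow> c \<in> carr A)"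

text \<open>
  Strict application of possibly undefined terms. Kleene equality of closed terms is
  then equality in the option type.
\<close>

definition sapp :: "'a pas \<Rightarrow> 'a option \<Rightarrow> 'a option \<Rightarrow> 'a option" where
  "sapp A t u = Option.bind t (\<lambda>a. Option.bind u (\<lambda>b. app A a b))"

definition combinators :: "'a pas \<Rightarrow> 'a \<Rightarrow> 'a \<Rightarrow> bool" where
  "combinators A k s \<longleftrightarrow> k \<in> carr A \<and> s \<in> carr A
    \<and> (\<forall>a\<in>carr A. \<forall>b\<in>carr A.
         app A k a \<noteq> None \<and> sapp A (app A k a) (Some b) = Some a)
    \<and> (\<forall>a\<in>carr A. \<forall>b\<in>carr A. \<forall>c\<in>carr A.
         sapp A (app A s a) (Some b) \<noteq> None
         \<and> sapp A (sapp A (app A s a) (Some b)) (Some c) = sapp A (app A a c) (app A b c))"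

definition pca :: "'a pas \<Rightarrow> bool" where
  "pca A \<longleftrightarrow> is_pas A \<and> (\<exists>a\<in>carr A. \<exists>b\<in>carr A. a \<noteq> b) \<and> (\<exists>k s. combinators A k s)"

definition combinatory_algebra :: "'a pas \<Rightarrow> bool" where
  "combinatory_algebra A \<longleftrightarrow> pca A \<and> (\<forall>a\<in>carr A. \<forall>b\<in>carr A. app A a b \<noteq> None)"

definition weak_embedding :: "'a pas \<Rightarrow> 'b pas \<Rightarrow> ('a \<Rightarrow> 'b) \<Rightarrow> bool" where
  "weak_embedding A B f \<longleftrightarrow> pca A \<and> pca B \<and> f ` carr A \<subseteq> carr B \<and> inj_on f (carr A)
    \<and> (\<forall>a\<in>carr A. \<forall>b\<in>carr A. \<forall>c. app A a b = Some c \<longrightarrow> app B (f a) (f b) = Some (f c))"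

definition strong_embedding :: "'a pas \<Rightarrow> 'b pas \<Rightarrow> ('a \<Rightarrow> 'b) \<Rightarrow> bool" where
  "strong_embedding A B f \<longleftrightarrow> weak_embedding A B f
    \<and> (\<exists>k s. combinators A k s \<and> combinators B (f k) (f s))"

definition strong_completion :: "'a pas \<Rightarrow> 'b pas \<Rightarrow> bool" where
  "strong_completion A B \<longleftrightarrow> combinatory_algebra B \<and> (\<exists>f. strong_embedding A B f)"

text \<open>
  Such an algebra is countable, so up to isomorphism its carrier may be taken to be a
  set of natural numbers.
\<close>

definition computable_algebra :: "nat set \<Rightarrow> 'a pas \<Rightarrow> bool" where
  "computable_algebra Y A \<longleftrightarrow> combinatory_algebra A
    \<and> (\<exists>\<gamma> \<psi>. range \<gamma> = carr A \<and> computable2_in Y \<psi>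
         \<and> (\<forall>n m. app A (\<gamma> n) (\<gamma> m) = Some (\<gamma> (\<psi> n m)))
         \<and> {prod_encode (n, m) | n m. \<gamma> n = \<gamma> m} \<le>\<^sub>T Y)"

text \<open>Partial computable means partial recursive in the empty oracle.\<close>

definition K1 :: "nat pas" where
  "K1 = \<lparr>carr = UNIV, app = phi {}\<rparr>"

end

theory Submission
  imports Defs "HOL-Library.Infinite_Set"
begin

text \<open>
  The strong completions of \<open>K1\<close> that are generated by its constants correspond to congruences
  on closed applicative terms that respect convergent applications and the laws for \<open>k\<close> and
  \<open>s\<close> and keep the constants apart. The set of codes of such congruences is a
  \<open>\<Pi>\<^sup>0\<^sub>1\<close> class, so by the low basis theorem it has a low member once it is nonempty,
  and a low member is at once a decidable equality for the resulting algebra.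

  A member is obtained from the Engeler graph model over the atoms \<open>\<omega>\<close>. Choose \<open>k\<close> and
  \<open>s\<close> in \<open>K1\<close> such that \<open>k\<close>, \<open>s\<close>, \<open>ka\<close>, \<open>sa\<close>, \<open>sab\<close> are pairwise
  distinct for all \<open>a\<close> and \<open>b\<close>. A number \<open>n\<close> not of these shapes is
  represented by its atom together with all arrows from the atom \<open>m\<close> to the elements representing
  \<open>n m\<close>, whereas the remaining numbers are represented by their atoms and the graphs of the operations
  that the combinator laws prescribe.
\<close>

section \<open>Uniformly computable functionals\<close>

abbreviation p1 :: "nat \<Rightarrow> nat" where "p1 x \<equiv> fst (prod_decode x)"
abbreviation p2 :: "nat \<Rightarrow> nat" where "p2 x \<equiv> snd (prod_decode x)"

text \<open>One program has to serve every oracle: the low basis theorem needs an index that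
  expresses the same condition for all \<open>Y\<close>, before the eventual \<open>Y\<close> is
  known.\<close>

definition unif :: "(nat set \<Rightarrow> nat \<Rightarrow> nat) \<Rightarrow> bool" where
  "unif F \<longleftrightarrow> (\<exists>c. \<forall>Y x. eval Y c x = Some (F Y x))"

primrec const_code :: "nat \<Rightarrow> code" where
  "const_code 0 = Zero"
| "const_code (Suc n) = Comp Succ (const_code n)"

lemma eval_const_code [simp]: "eval Y (const_code n) x = Some n"
  by (induction n) auto

lemma const_code_inject [simp]: "const_code m = const_code n \<longleftrightarrow> m = n"
proof (induction m arbitrary: n)
  case 0 then show ?case by (cases n) auto
next
  case (Suc m) then show ?case by (cases n) auto
qed

definition id_code :: code where "id_code = Pair Fst Snd"

lemma eval_id_code [simp]: "eval Y id_code x = Some x"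
  by (simp add: id_code_def)

lemma unif_id: "unif (\<lambda>Y x. x)"
  unfolding unif_def using eval_id_code by blast

lemma unif_const: "unif (\<lambda>Y x. n)"
  unfolding unif_def using eval_const_code by blast

lemma unif_comp:
  assumes "unif F" "unif f"
  shows "unif (\<lambda>Y x. F Y (f Y x))"
proof -
  obtain c d where "\<forall>Y x. eval Y c x = Some (F Y x)" "\<forall>Y x. eval Y d x = Some (f Y x)"
    using assms unfolding unif_def by blast
  then have "\<forall>Y x. eval Y (Comp c d) x = Some (F Y (f Y x))" by simp
  then show ?thesis unfolding unif_def by blast
qed

lemma unif_Suc: "unif f \<Longrightarrow> unif (\<lambda>Y x. Suc (f Y x))"
  by (rule unif_comp[of "\<lambda>Y. Suc"]) (auto simp: unif_def intro: exI[of _ Succ])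

lemma unif_fst: "unif f \<Longrightarrow> unif (\<lambda>Y x. p1 (f Y x))"
  by (rule unif_comp[of "\<lambda>Y. p1"]) (auto simp: unif_def intro: exI[of _ Fst])

lemma unif_snd: "unif f \<Longrightarrow> unif (\<lambda>Y x. p2 (f Y x))"
  by (rule unif_comp[of "\<lambda>Y. p2"]) (auto simp: unif_def intro: exI[of _ Snd])

lemma unif_oracle: "unif f \<Longrightarrow> unif (\<lambda>Y x. if f Y x \<in> Y then 1 else 0)"
  by (rule unif_comp[of "\<lambda>Y x. if x \<in> Y then 1 else 0"])
    (auto simp: unif_def intro!: exI[of _ Oracle])

lemma unif_pair:
  assumes "unif f" "unif g"
  shows "unif (\<lambda>Y x. prod_encode (f Y x, g Y x))"
proof -
  obtain c d where "\<forall>Y x. eval Y c x = Some (f Y x)" "\<forall>Y x. eval Y d x = Some (g Y x)"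
    using assms unfolding unif_def by blast
  then have "\<forall>Y x. eval Y (Pair c d) x = Some (prod_encode (f Y x, g Y x))" by simp
  then show ?thesis unfolding unif_def by blast
qed

text \<open>The step hypothesis concerns a single \<open>z\<close> coding parameter, counter and
  previous value, since this is what \<open>Prec\<close> hands to its second program. The parameter
  is the whole input \<open>x\<close>, so bodies mentioning \<open>x\<close> are allowed.\<close>

lemma unif_rec:
  assumes "unif b" "unif (\<lambda>Y z. s Y (p1 z) (p1 (p2 z)) (p2 (p2 z)))" "unif n"
  shows "unif (\<lambda>Y x. rec_nat (b Y x) (s Y x) (n Y x))"
proof -
  obtain c d where c: "\<forall>Y x. eval Y c x = Some (b Y x)"
    and d: "\<forall>Y z. eval Y d z = Some (s Y (p1 z) (p1 (p2 z)) (p2 (p2 z)))"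
    using assms unfolding unif_def by blast
  have "eval Y (Prec c d) (prod_encode (x, m)) = Some (rec_nat (b Y x) (s Y x) m)" for Y x m
    using c d by (induction m) simp_all
  then have "eval Y (Prec c d) z = Some (rec_nat (b Y (p1 z)) (s Y (p1 z)) (p2 z))" for Y z
    by (metis prod.collapse prod_decode_inverse)
  then have "unif (\<lambda>Y z. rec_nat (b Y (p1 z)) (s Y (p1 z)) (p2 z))"
    unfolding unif_def by blast
  from unif_comp[OF this unif_pair[OF unif_id assms(3)]] show ?thesis by simp
qed

lemma unif_add:
  assumes "unif f" "unif g"
  shows "unif (\<lambda>Y x. f Y x + g Y x)"
proof -
  have "rec_nat a (\<lambda>i r. Suc r) m = a + m" for a m by (induction m) auto
  moreover have "unif (\<lambda>Y x. rec_nat (f Y x) (\<lambda>i r. Suc r) (g Y x))"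
    by (intro unif_rec unif_Suc unif_fst unif_snd unif_id assms)
  ultimately show ?thesis by simp
qed

lemma unif_mult:
  assumes "unif f" "unif g"
  shows "unif (\<lambda>Y x. f Y x * g Y x)"
proof -
  have "rec_nat 0 (\<lambda>i r. a + r) m = a * m" for a m :: nat by (induction m) auto
  moreover have "unif (\<lambda>Y x. rec_nat 0 (\<lambda>i r. f Y x + r) (g Y x))"
    by (intro unif_rec unif_add unif_fst unif_snd unif_id unif_const unif_comp[OF assms(1)] assms(2))
  ultimately show ?thesis by simp
qed

lemma unif_diff:
  assumes "unif f" "unif g"
  shows "unif (\<lambda>Y x. f Y x - g Y x)"
proof -
  have pred: "unif (\<lambda>Y x. f Y x - 1)" if "unif f" for f
  proof -
    have "rec_nat 0 (\<lambda>i r. i) m = m - 1" for m :: nat by (cases m) auto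
    moreover have "unif (\<lambda>Y x. rec_nat 0 (\<lambda>i r. i) (f Y x))"
      by (intro unif_rec unif_fst unif_snd unif_id unif_const that)
    ultimately show ?thesis by simp
  qed
  have "rec_nat a (\<lambda>i r. r - 1) m = a - m" for a m :: nat by (induction m) auto
  moreover have "unif (\<lambda>Y x. rec_nat (f Y x) (\<lambda>i r. r - 1) (g Y x))"
    by (intro unif_rec pred unif_fst unif_snd unif_id assms)
  ultimately show ?thesis by simp
qed

lemma unif_div2:
  assumes "unif f"
  shows "unif (\<lambda>Y x. f Y x div 2)"
proof -
  \<comment> \<open>The induction step is \<open>i - i div 2 = Suc i div 2\<close>.\<close>
  have "rec_nat 0 (\<lambda>i r. i - r) m = m div 2" for m :: nat by (induction m) auto
  moreover have "unif (\<lambda>Y x. rec_nat 0 (\<lambda>i r. i - r) (f Y x))"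
    by (intro unif_rec unif_diff unif_fst unif_snd unif_id unif_const assms)
  ultimately show ?thesis by simp
qed

lemma unif_power2:
  assumes "unif f"
  shows "unif (\<lambda>Y x. 2 ^ f Y x)"
proof -
  have "rec_nat 1 (\<lambda>i r. 2 * r) m = (2::nat) ^ m" for m :: nat by (induction m) auto
  moreover have "unif (\<lambda>Y x. rec_nat 1 (\<lambda>i r. 2 * r) (f Y x))"
    by (intro unif_rec unif_mult unif_fst unif_snd unif_id unif_const assms)
  ultimately show ?thesis by simp
qed

section \<open>Predicates decidable uniformly in the oracle\<close>

definition dec :: "(nat set \<Rightarrow> nat \<Rightarrow> bool) \<Rightarrow> bool" where
  "dec P \<longleftrightarrow> unif (\<lambda>Y x. if P Y x then 1 else 0)"

lemma unif_if:
  assumes "dec P" "unif f" "unif g"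
  shows "unif (\<lambda>Y x. if P Y x then f Y x else g Y x)"
proof -
  have "unif (\<lambda>Y x. f Y x * (if P Y x then 1 else 0) + g Y x * (1 - (if P Y x then 1 else 0)))"
    using assms(1) unfolding dec_def
    by (intro unif_add unif_mult unif_diff unif_const assms(2,3))
  moreover have "(\<lambda>Y x. f Y x * (if P Y x then 1 else 0) + g Y x * (1 - (if P Y x then 1 else 0)))
    = (\<lambda>Y x. if P Y x then f Y x else g Y x)" by (intro ext) auto
  ultimately show ?thesis by simp
qed

lemma dec_comp: "dec P \<Longrightarrow> unif f \<Longrightarrow> dec (\<lambda>Y x. P Y (f Y x))"
  unfolding dec_def using unif_comp by blast

lemma dec_mem: "unif f \<Longrightarrow> dec (\<lambda>Y x. f Y x \<in> Y)"
  unfolding dec_def by (rule unif_oracle)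

lemma dec_not: "dec P \<Longrightarrow> dec (\<lambda>Y x. \<not> P Y x)"
proof -
  assume "dec P"
  then have "unif (\<lambda>Y x. if P Y x then 0 else 1)"
    by (intro unif_if unif_const)
  moreover have "(\<lambda>Y x. if P Y x then 0 else (1::nat)) = (\<lambda>Y x. if \<not> P Y x then 1 else 0)"
    by (intro ext) auto
  ultimately show ?thesis unfolding dec_def by simp
qed

lemma dec_conj: "dec P \<Longrightarrow> dec Q \<Longrightarrow> dec (\<lambda>Y x. P Y x \<and> Q Y x)"
proof -
  assume "dec P" "dec Q"
  then have "unif (\<lambda>Y x. if P Y x then (if Q Y x then 1 else 0) else 0)"
    by (intro unif_if unif_const)
  moreover have "(\<lambda>Y x. if P Y x then (if Q Y x then 1 else 0) else (0::nat))
    = (\<lambda>Y x. if P Y x \<and> Q Y x then 1 else 0)" by (intro ext) auto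
  ultimately show ?thesis unfolding dec_def by simp
qed

lemma dec_disj: "dec P \<Longrightarrow> dec Q \<Longrightarrow> dec (\<lambda>Y x. P Y x \<or> Q Y x)"
  using dec_not[OF dec_conj[OF dec_not dec_not]] by simp

lemma dec_le:
  assumes "unif f" "unif g"
  shows "dec (\<lambda>Y x. f Y x \<le> g Y x)"
proof -
  have "unif (\<lambda>Y x. 1 - (f Y x - g Y x))"
    by (intro unif_diff unif_const assms)
  moreover have "(\<lambda>Y x. 1 - (f Y x - g Y x)) = (\<lambda>Y x. if f Y x \<le> g Y x then 1 else 0)"
    by (intro ext) auto
  ultimately show ?thesis unfolding dec_def by simp
qed

lemma dec_less: "unif f \<Longrightarrow> unif g \<Longrightarrow> dec (\<lambda>Y x. f Y x < g Y x)"
  using dec_not[OF dec_le[of g f]] by (simp add: not_le)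

lemma dec_eq: "unif f \<Longrightarrow> unif g \<Longrightarrow> dec (\<lambda>Y x. f Y x = g Y x)"
  using dec_conj[OF dec_le[of f g] dec_le[of g f]] by (simp add: eq_iff)

lemma dec_ex_less:
  assumes "dec (\<lambda>Y z. P Y (p1 z) (p2 z))" "unif n"
  shows "dec (\<lambda>Y x. \<exists>i<n Y x. P Y x i)"
proof -
  have "rec_nat 0 (\<lambda>i r. if P Y x i \<or> 0 < r then 1 else (0::nat)) m
      = (if \<exists>i<m. P Y x i then 1 else 0)" for Y x m
    by (induction m) (auto simp: less_Suc_eq)
  moreover have "dec (\<lambda>Y z. P Y (p1 z) (p1 (p2 z)))"
    using dec_comp[OF assms(1) unif_pair[OF unif_fst[OF unif_id] unif_fst[OF unif_snd[OF unif_id]]]]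
    by simp
  then have "unif (\<lambda>Y x. rec_nat 0 (\<lambda>i r. if P Y x i \<or> 0 < r then 1 else (0::nat)) (n Y x))"
    by (intro unif_rec unif_if dec_disj dec_less unif_fst unif_snd unif_id unif_const assms(2))
  ultimately show ?thesis unfolding dec_def by simp
qed

lemma dec_all_less:
  assumes "dec (\<lambda>Y z. P Y (p1 z) (p2 z))" "unif n"
  shows "dec (\<lambda>Y x. \<forall>i<n Y x. P Y x i)"
  using dec_not[OF dec_ex_less[of "\<lambda>Y x i. \<not> P Y x i", OF dec_not[OF assms(1)] assms(2)]] by simp

lemma dec_odd:
  assumes "unif f" shows "dec (\<lambda>Y x. odd (f Y x))"
proof -
  have "odd a \<longleftrightarrow> a div 2 + a div 2 < a" for a :: nat by presburger
  then show ?thesis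
    using dec_less[OF unif_add[OF unif_div2 unif_div2] assms, OF assms assms] by simp
qed

lemma dec_set_decode:
  assumes "unif f" "unif g" shows "dec (\<lambda>Y x. f Y x \<in> set_decode (g Y x))"
proof -
  have "rec_nat a (\<lambda>i r. r div 2) m = a div 2 ^ m" for a m :: nat
    by (induction m) (auto simp: div_mult2_eq[symmetric] mult.commute)
  moreover have "unif (\<lambda>Y x. rec_nat (g Y x) (\<lambda>i r. r div 2) (f Y x))"
    by (intro unif_rec unif_div2 unif_fst unif_snd unif_id assms)
  ultimately show ?thesis using dec_odd by (simp add: set_decode_def)
qed

lemmas unif_basic = unif_id unif_Suc unif_fst unif_snd unif_pair unif_add unif_mult
  unif_diff unif_div2 unif_power2 unif_if unif_const
  dec_mem dec_not dec_conj dec_disj dec_le dec_less dec_eq dec_set_decode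

section \<open>An abstract machine with bounded oracle\<close>

text \<open>
  Queries to the oracle \<open>Y\<close> are answered only below \<open>N\<close>; on a larger query the machine
  is stuck. A halting computation thus depends on \<open>Y \<inter> {..<N}\<close> alone.
\<close>

datatype frame = FFst code nat | FSnd nat | FComp code | FPrec code nat nat | FMu code nat nat

datatype conf = Call code nat "frame list" | Ret nat "frame list"

context
  fixes N :: nat and Y :: "nat set"
begin

text \<open>Being stuck means repeating the same configuration, which keeps \<open>step\<close>
  total. The halted configurations \<open>Ret v []\<close> are fixed points as well, so halting
  persists.\<close>

fun call :: "code \<Rightarrow> nat \<Rightarrow> frame list \<Rightarrow> conf" where
  "call Zero x K = Ret 0 K"
| "call Succ x K = Ret (Suc x) K"
| "call Fst x K = Ret (p1 x) K"
| "call Snd x K = Ret (p2 x) K"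
| "call Oracle x K = (if x < N then Ret (if x \<in> Y then 1 else 0) K else Call Oracle x K)"
| "call (Pair c d) x K = Call c x (FFst d x # K)"
| "call (Comp c d) x K = Call d x (FComp c # K)"
| "call (Prec c d) x K = (if p2 x = 0 then Call c (p1 x) K
     else Call (Prec c d) (prod_encode (p1 x, p2 x - 1)) (FPrec d (p1 x) (p2 x - 1) # K))"
| "call (Mu c) x K = Call c (prod_encode (x, 0)) (FMu c x 0 # K)"

fun ret :: "nat \<Rightarrow> frame list \<Rightarrow> conf" where
  "ret v [] = Ret v []"
| "ret v (FFst d x # K) = Call d x (FSnd v # K)"
| "ret v (FSnd u # K) = Ret (prod_encode (u, v)) K"
| "ret v (FComp c # K) = Call c v K"
| "ret v (FPrec d a i # K) = Call d (prod_encode (a, prod_encode (i, v))) K"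
| "ret v (FMu c x i # K) = (if v = 0 then Ret i K
     else Call c (prod_encode (x, Suc i)) (FMu c x (Suc i) # K))"

primrec step :: "conf \<Rightarrow> conf" where
  "step (Call c x K) = call c x K"
| "step (Ret v K) = ret v K"

end

section \<open>Correctness of the machine\<close>

definition mu_from :: "nat set \<Rightarrow> code \<Rightarrow> nat \<Rightarrow> nat \<Rightarrow> nat option" where
  "mu_from Y c x i = (if \<exists>n\<ge>i. eval Y c (prod_encode (x, n)) = Some 0
        \<and> (\<forall>j. i \<le> j \<and> j < n \<longrightarrow> eval Y c (prod_encode (x, j)) \<noteq> None)
     then Some (LEAST n. i \<le> n \<and> eval Y c (prod_encode (x, n)) = Some 0) else None)"

lemma eval_Mu: "eval Y (Mu c) x = mu_from Y c x 0"
  by (simp add: mu_from_def)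

text \<open>A frame \<open>FMu c x i\<close> has forgotten the failed candidates below
  \<open>i\<close>, so the meaning of a configuration involves minimisation restarted at
  \<open>i\<close>. This equation performs one test of that search.\<close>

lemma mu_from_rec: "mu_from Y c x i = Option.bind (eval Y c (prod_encode (x, i)))
   (\<lambda>v. if v = 0 then Some i else mu_from Y c x (Suc i))"
proof (cases "eval Y c (prod_encode (x, i))")
  case None
  then show ?thesis by (auto simp: mu_from_def) (metis None le_less option.distinct(1))
next
  case (Some v)
  show ?thesis
  proof (cases "v = 0")
    case True
    have "(LEAST n. i \<le> n \<and> eval Y c (prod_encode (x, n)) = Some 0) = i"
      using Some True by (intro Least_equality) auto
    moreover have "\<exists>n\<ge>i. eval Y c (prod_encode (x, n)) = Some 0
        \<and> (\<forall>j. i \<le> j \<and> j < n \<longrightarrow> eval Y c (prod_encode (x, j)) \<noteq> None)"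
      using Some True by (intro exI[of _ i]) auto
    ultimately show ?thesis using Some True by (simp add: mu_from_def)
  next
    case False
    have *: "i \<le> n \<and> eval Y c (prod_encode (x, n)) = Some 0
      \<longleftrightarrow> Suc i \<le> n \<and> eval Y c (prod_encode (x, n)) = Some 0" for n
      using Some False by (cases "n = i") auto
    have "(\<exists>n\<ge>i. eval Y c (prod_encode (x, n)) = Some 0
        \<and> (\<forall>j. i \<le> j \<and> j < n \<longrightarrow> eval Y c (prod_encode (x, j)) \<noteq> None))
      \<longleftrightarrow> (\<exists>n\<ge>Suc i. eval Y c (prod_encode (x, n)) = Some 0
        \<and> (\<forall>j. Suc i \<le> j \<and> j < n \<longrightarrow> eval Y c (prod_encode (x, j)) \<noteq> None))"
      (is "?l = ?r")
    proof
      assume ?l then show ?r using * by (meson Suc_leD)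
    next
      assume ?r
      then obtain n where n: "n \<ge> Suc i" "eval Y c (prod_encode (x, n)) = Some 0"
        "\<forall>j. Suc i \<le> j \<and> j < n \<longrightarrow> eval Y c (prod_encode (x, j)) \<noteq> None" by blast
      then have "\<forall>j. i \<le> j \<and> j < n \<longrightarrow> eval Y c (prod_encode (x, j)) \<noteq> None"
        using Some by (metis le_antisym not_less_eq_eq option.distinct(1))
      then show ?l using n by (meson Suc_leD)
    qed
    then have "mu_from Y c x i = mu_from Y c x (Suc i)"
      unfolding mu_from_def by (simp only: *)
    then show ?thesis using Some False by simp
  qed
qed

primrec frame_sem :: "nat set \<Rightarrow> frame \<Rightarrow> nat \<Rightarrow> nat option" where
  "frame_sem Y (FFst d x) = (\<lambda>v. Option.bind (eval Y d x) (\<lambda>u. Some (prod_encode (v, u))))"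
| "frame_sem Y (FSnd u) = (\<lambda>v. Some (prod_encode (u, v)))"
| "frame_sem Y (FComp c) = eval Y c"
| "frame_sem Y (FPrec d a i) = (\<lambda>v. eval Y d (prod_encode (a, prod_encode (i, v))))"
| "frame_sem Y (FMu c x i) = (\<lambda>v. if v = 0 then Some i else mu_from Y c x (Suc i))"

primrec stack_sem :: "nat set \<Rightarrow> frame list \<Rightarrow> nat option \<Rightarrow> nat option" where
  "stack_sem Y [] r = r"
| "stack_sem Y (F # K) r = stack_sem Y K (Option.bind r (frame_sem Y F))"

primrec conf_sem :: "nat set \<Rightarrow> conf \<Rightarrow> nat option" where
  "conf_sem Y (Call c x K) = stack_sem Y K (eval Y c x)"
| "conf_sem Y (Ret v K) = stack_sem Y K (Some v)"

lemma eval_Prec_rec: "eval Y (Prec c d) x = (if p2 x = 0 then eval Y c (p1 x)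
   else Option.bind (eval Y (Prec c d) (prod_encode (p1 x, p2 x - 1)))
     (\<lambda>v. eval Y d (prod_encode (p1 x, prod_encode (p2 x - 1, v)))))"
  by (cases "prod_decode x"; cases "p2 x") auto

lemma bind_eq_comp: "Option.bind (Option.bind r f) g = Option.bind r (\<lambda>v. Option.bind (f v) g)"
  by (cases r) auto

text \<open>Soundness: the value denoted by a configuration is an invariant of the machine, whatever
  the query bound. A halted run therefore displays the value of its start configuration.\<close>

lemma conf_sem_step: "conf_sem Y (step N Y s) = conf_sem Y s"
proof (cases s)
  case (Call c x K)
  show ?thesis
  proof (cases c)
    case (Prec c1 d1)
    show ?thesis
      unfolding Call Prec conf_sem.simps step.simps call.simps
      by (subst eval_Prec_rec[of Y c1 d1 x]) (simp del: eval.simps)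
  next
    case (Mu c1)
    have "conf_sem Y s = stack_sem Y K (mu_from Y c1 x 0)"
      unfolding Call Mu conf_sem.simps eval_Mu ..
    also have "\<dots> = conf_sem Y (step N Y s)"
      unfolding Call Mu by (subst mu_from_rec) simp
    finally show ?thesis by simp
  qed (simp_all add: Call bind_eq_comp)
next
  case (Ret v K)
  show ?thesis
  proof (cases K)
    case (Cons F K')
    show ?thesis
    proof (cases F)
      case (FMu c x i)
      have "conf_sem Y (step N Y s) = stack_sem Y K' (if v = 0 then Some i else mu_from Y c x (Suc i))"
        unfolding Ret Cons FMu by (subst mu_from_rec) simp
      then show ?thesis by (simp add: Ret Cons FMu)
    qed (simp_all add: Ret Cons)
  qed (simp add: Ret)
qed

text \<open>The step count \<open>t\<close> is chosen before \<open>N\<close>: enlarging the query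
  bound beyond \<open>N0\<close> leaves the length of the computation unchanged.\<close>

definition reaches :: "nat set \<Rightarrow> conf \<Rightarrow> conf \<Rightarrow> bool" where
  "reaches Y s s' \<longleftrightarrow> (\<exists>N0 t. \<forall>N\<ge>N0. (step N Y ^^ t) s = s')"

lemma reaches_refl: "reaches Y s s"
  unfolding reaches_def by (intro exI[of _ 0]) auto

lemma reaches_trans [trans]:
  assumes "reaches Y s s'" "reaches Y s' s''" shows "reaches Y s s''"
proof -
  obtain N0 t N1 t' where *: "\<forall>N\<ge>N0. (step N Y ^^ t) s = s'" "\<forall>N\<ge>N1. (step N Y ^^ t') s' = s''"
    using assms unfolding reaches_def by blast
  then have "\<forall>N\<ge>max N0 N1. (step N Y ^^ (t' + t)) s = s''"
    by (simp add: funpow_add)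
  then show ?thesis unfolding reaches_def by blast
qed

lemma reaches_step: "(\<And>N. step N Y s = s') \<Longrightarrow> reaches Y s' s'' \<Longrightarrow> reaches Y s s''"
  by (rule reaches_trans[of Y s s']) (auto simp: reaches_def intro!: exI[of _ 1])

lemma reaches_Ret: "eval Y c x = Some v \<Longrightarrow> reaches Y (Call c x K) (Ret v K)"
proof (induction c arbitrary: x v K)
  case Oracle
  then have "\<forall>N\<ge>Suc x. (step N Y ^^ 1) (Call Oracle x K) = Ret v K" by auto
  then show ?case unfolding reaches_def by blast
next
  case (Pair c d)
  then obtain a b where *: "eval Y c x = Some a" "eval Y d x = Some b" "v = prod_encode (a, b)"
    by (auto split: bind_splits)
  show ?case
    apply (rule reaches_step, simp)
    apply (rule reaches_trans[OF Pair.IH(1)[OF *(1)]])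
    apply (rule reaches_step, simp)
    apply (rule reaches_trans[OF Pair.IH(2)[OF *(2)]])
    by (rule reaches_step, simp, simp add: * reaches_refl)
next
  case (Comp c d)
  then obtain a where *: "eval Y d x = Some a" "eval Y c a = Some v"
    by (auto split: bind_splits)
  show ?case
    apply (rule reaches_step, simp)
    apply (rule reaches_trans[OF Comp.IH(2)[OF *(1)]])
    apply (rule reaches_step, simp)
    by (rule Comp.IH(1)[OF *(2)])
next
  case (Prec c d)
  have "eval Y (Prec c d) (prod_encode (a, n)) = Some v
    \<Longrightarrow> reaches Y (Call (Prec c d) (prod_encode (a, n)) K) (Ret v K)" for a n v K
  proof (induction n arbitrary: v K)
    case 0
    then have "eval Y c a = Some v" by simp
    from Prec.IH(1)[OF this] show ?case by (rule reaches_step[rotated]) simp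
  next
    case (Suc n)
    then obtain u where u: "eval Y (Prec c d) (prod_encode (a, n)) = Some u"
      "eval Y d (prod_encode (a, prod_encode (n, u))) = Some v"
      by (auto split: bind_splits)
    show ?case
      apply (rule reaches_step, simp)
      apply (rule reaches_trans[OF Suc.IH[OF u(1)]])
      apply (rule reaches_step, simp)
      by (rule Prec.IH(2)[OF u(2)])
  qed
  from this[of "p1 x" "p2 x"] Prec.prems show ?case by simp
next
  case (Mu c)
  \<comment> \<open>Downward induction, from the successful candidate \<open>n\<close> to the
    candidate \<open>i\<close> under test.\<close>
  have *: "reaches Y (Call c (prod_encode (x, i)) (FMu c x i # K)) (Ret n K)"
    if "i \<le> n" and n0: "eval Y c (prod_encode (x, n)) = Some 0"
      and nS: "\<forall>j<n. \<exists>u. eval Y c (prod_encode (x, j)) = Some (Suc u)" for i n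
    using \<open>i \<le> n\<close>
  proof (induction rule: inc_induct)
    case base
    show ?case
      by (rule reaches_trans[OF Mu.IH[OF n0]]) (rule reaches_step, simp, simp add: reaches_refl)
  next
    case (step m)
    then obtain u where u: "eval Y c (prod_encode (x, m)) = Some (Suc u)" using nS by blast
    show ?case
      by (rule reaches_trans[OF Mu.IH[OF u]]) (rule reaches_step, simp, rule step.IH)
  qed
  have ex: "\<exists>n. eval Y c (prod_encode (x, n)) = Some 0
            \<and> (\<forall>i<n. eval Y c (prod_encode (x, i)) \<noteq> None)"
    and v: "v = (LEAST n. eval Y c (prod_encode (x, n)) = Some 0)"
    using Mu.prems by (auto split: if_splits)
  then have v0: "eval Y c (prod_encode (x, v)) = Some 0" by (metis (mono_tags, lifting) LeastI)
  have "\<exists>u. eval Y c (prod_encode (x, j)) = Some (Suc u)" if "j < v" for j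
  proof -
    have "eval Y c (prod_encode (x, j)) \<noteq> Some 0" using that v not_less_Least by blast
    moreover have "eval Y c (prod_encode (x, j)) \<noteq> None"
      using ex that v by (metis (mono_tags, lifting) Least_le less_le_trans)
    ultimately show ?thesis by (metis not0_implies_Suc option.exhaust)
  qed
  with v0 show ?case by (intro reaches_step[OF _ *[of 0]]) auto
qed (auto intro!: reaches_step[OF _ reaches_refl])

definition start :: "nat \<Rightarrow> nat \<Rightarrow> conf" where
  "start e x = Call (inv encode e) x []"

text \<open>The number \<open>N\<close> bounds both the queries and the time, so that a single
  parameter measures a computation and later searches range over one variable.\<close>

definition run :: "nat \<Rightarrow> nat set \<Rightarrow> nat \<Rightarrow> nat \<Rightarrow> conf" where
  "run N Y e x = (step N Y ^^ N) (start e x)"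

text \<open>A step that changes the configuration makes no query at or above \<open>N\<close>, so
  both machines agree on it. A step that changes nothing fixes the configuration forever, so that
  this configuration is already \<open>Ret v []\<close>.\<close>

lemma funpow_step_mono:
  assumes "(step N Y ^^ t) s = Ret v []" "N \<le> M" "Y \<inter> {..<N} = Z \<inter> {..<N}" "t \<le> u"
  shows "(step M Z ^^ u) s = Ret v []"
proof -
  have fixN: "step N Y s = s \<Longrightarrow> (step N Y ^^ t) s = s" for s t
    by (induction t) auto
  have fixM: "(step M Z ^^ t) (Ret v []) = Ret v []" for t
    by (induction t) auto
  have "(step M Z ^^ t) s = Ret v []" using assms(1)
  proof (induction t arbitrary: s)
    case (Suc t s)
    show ?case
    proof (cases "step N Y s = s")
      case True
      then have "(step N Y ^^ Suc t) s = s" by (rule fixN)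
      from trans[OF sym[OF this] Suc.prems] have "s = Ret v []" .
      moreover have "(step M Z ^^ Suc t) (Ret v []) = Ret v []"
        by (rule fixM)
      ultimately show ?thesis by simp
    next
      case False
      have "step N Y s = step M Z s"
      proof (cases s)
        case (Call c x K)
        show ?thesis
        proof (cases c)
          case Oracle
          have "x < N"
          proof (rule ccontr)
            assume "\<not> x < N"
            then have "step N Y s = s" by (simp add: Call Oracle)
            with False show False ..
          qed
          then have "x < M" "x \<in> Y \<longleftrightarrow> x \<in> Z" using assms(2,3) by auto
          with \<open>x < N\<close> show ?thesis by (simp add: Call Oracle)
        qed (simp_all add: Call)
      next
        case (Ret v K)
        then show ?thesis
        proof (cases K)
          case (Cons F K')
          then show ?thesis using Ret by (cases F) auto
        qed simp
      qed
      then show ?thesis using Suc by (simp add: funpow_Suc_right del: funpow.simps)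
    qed
  qed auto
  moreover have "(step M Z ^^ u) s = (step M Z ^^ (u - t)) ((step M Z ^^ t) s)"
    using assms(4) by (metis (no_types) comp_apply funpow_add le_add_diff_inverse2)
  moreover have "(step M Z ^^ (u - t)) (Ret v []) = Ret v []"
    by (rule fixM)
  ultimately show ?thesis by simp
qed

lemma run_mono:
  "run N Y e x = Ret v [] \<Longrightarrow> N \<le> M \<Longrightarrow> Y \<inter> {..<N} = Z \<inter> {..<N} \<Longrightarrow> run M Z e x = Ret v []"
  unfolding run_def by (rule funpow_step_mono)

lemma phi_eq_Some_iff: "phi Y e x = Some v \<longleftrightarrow> (\<exists>N. run N Y e x = Ret v [])"
proof
  assume "phi Y e x = Some v"
  then have "reaches Y (start e x) (Ret v [])"
    unfolding phi_def start_def by (rule reaches_Ret)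
  then obtain N0 t where *: "\<forall>N\<ge>N0. (step N Y ^^ t) (start e x) = Ret v []"
    unfolding reaches_def by blast
  \<comment> \<open>\<open>N0\<close> suffices for the queries and \<open>t\<close> for the time;
    their maximum provides both.\<close>
  have "run (max N0 t) Y e x = Ret v []"
    unfolding run_def
    by (rule funpow_step_mono[where N = "max N0 t" and Y = Y and t = t]) (use * in auto)
  then show "\<exists>N. run N Y e x = Ret v []" ..
next
  assume "\<exists>N. run N Y e x = Ret v []"
  then obtain N where *: "(step N Y ^^ N) (start e x) = Ret v []" unfolding run_def by blast
  have "conf_sem Y ((step N Y ^^ t) s) = conf_sem Y s" for t s
    by (induction t) (auto simp: conf_sem_step)
  from this[of N "start e x"] have "conf_sem Y (Ret v []) = conf_sem Y (start e x)"
    unfolding * .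
  then show "phi Y e x = Some v" by (simp add: start_def phi_def)
qed

section \<open>Arithmetisation of the machine\<close>

primrec frame_enc :: "frame \<Rightarrow> nat" where
  "frame_enc (FFst c x) = prod_encode (0, prod_encode (encode c, x))"
| "frame_enc (FSnd u) = prod_encode (1, u)"
| "frame_enc (FComp c) = prod_encode (2, encode c)"
| "frame_enc (FPrec c a i) = prod_encode (3, prod_encode (encode c, prod_encode (a, i)))"
| "frame_enc (FMu c x i) = prod_encode (4, prod_encode (encode c, prod_encode (x, i)))"

abbreviation push_enc :: "nat \<Rightarrow> nat \<Rightarrow> nat" where
  "push_enc F K \<equiv> Suc (prod_encode (F, K))"

primrec stack_enc :: "frame list \<Rightarrow> nat" where
  "stack_enc [] = 0"
| "stack_enc (F # K) = push_enc (frame_enc F) (stack_enc K)"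

abbreviation call_enc :: "nat \<Rightarrow> nat \<Rightarrow> nat \<Rightarrow> nat" where
  "call_enc e x K \<equiv> prod_encode (Suc e, prod_encode (x, K))"

abbreviation ret_enc :: "nat \<Rightarrow> nat \<Rightarrow> nat" where
  "ret_enc v K \<equiv> prod_encode (0, prod_encode (v, K))"

primrec conf_enc :: "conf \<Rightarrow> nat" where
  "conf_enc (Call c x K) = call_enc (encode c) x (stack_enc K)"
| "conf_enc (Ret v K) = ret_enc v (stack_enc K)"

lemma conf_enc_halted: "conf_enc s = ret_enc v 0 \<longleftrightarrow> s = Ret v []"
proof (cases s)
  case (Ret u K) then show ?thesis by (cases K) auto
qed auto

text \<open>Rounding down in \<open>(e - 5) div 4\<close> absorbs the four tags 5 to 8 of
  \<open>encode\<close>: \<open>q\<close> is the coded pair of subprograms for the binary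
  constructors, and the code of the body itself for \<open>Mu\<close>.\<close>

definition call_num :: "nat \<Rightarrow> nat \<Rightarrow> nat \<Rightarrow> nat \<Rightarrow> nat \<Rightarrow> nat" where
  "call_num N S e x K =
    (if e = 0 then ret_enc 0 K
     else if e = 1 then ret_enc (Suc x) K
     else if e = 2 then ret_enc (p1 x) K
     else if e = 3 then ret_enc (p2 x) K
     else if e = 4 then
       (if x < N then ret_enc (if x \<in> set_decode S then 1 else 0) K else call_enc e x K)
     else let q = (e - 5) div 4; c = p1 q; d = p2 q in
       if e = 5 + 4 * q then call_enc c x (push_enc (prod_encode (0, prod_encode (d, x))) K)
       else if e = 6 + 4 * q then call_enc d x (push_enc (prod_encode (2, c)) K)
       else if e = 7 + 4 * q then
         (if p2 x = 0 then call_enc c (p1 x) K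
          else call_enc e (prod_encode (p1 x, p2 x - 1))
            (push_enc (prod_encode (3, prod_encode (d, prod_encode (p1 x, p2 x - 1)))) K))
       else call_enc q (prod_encode (x, 0))
         (push_enc (prod_encode (4, prod_encode (q, prod_encode (x, 0)))) K))"

definition ret_num :: "nat \<Rightarrow> nat \<Rightarrow> nat" where
  "ret_num v K = (if K = 0 then ret_enc v 0
     else let F = p1 (K - 1); K' = p2 (K - 1); a = p2 F; c = p1 a; x = p1 (p2 a); i = p2 (p2 a) in
       if p1 F = 0 then call_enc c (p2 a) (push_enc (prod_encode (1, v)) K')
       else if p1 F = 1 then ret_enc (prod_encode (a, v)) K'
       else if p1 F = 2 then call_enc a v K'
       else if p1 F = 3 then call_enc c (prod_encode (x, prod_encode (i, v))) K'
       else if v = 0 then ret_enc i K'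
       else call_enc c (prod_encode (x, Suc i))
         (push_enc (prod_encode (4, prod_encode (c, prod_encode (x, Suc i)))) K'))"

definition step_num :: "nat \<Rightarrow> nat \<Rightarrow> nat \<Rightarrow> nat" where
  "step_num N S z = (if p1 z = 0 then ret_num (p1 (p2 z)) (p2 (p2 z))
     else call_num N S (p1 z - 1) (p1 (p2 z)) (p2 (p2 z)))"

lemma call_num_eq: "call_num N S (encode c) x (stack_enc K) = conf_enc (call N (set_decode S) c x K)"
proof (cases c)
  case (Comp c d)
  have "(1 + 4 * q) div 4 = q" for q :: nat by simp
  then show ?thesis using Comp by (simp add: call_num_def Let_def)
next
  case (Prec c d)
  have "(2 + 4 * q) div 4 = q" for q :: nat by simp
  then show ?thesis using Prec by (simp add: call_num_def Let_def)
next
  case (Mu c)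
  have "(3 + 4 * q) div 4 = q" for q :: nat by simp
  then show ?thesis using Mu by (simp add: call_num_def Let_def)
qed (simp_all add: call_num_def Let_def)

lemma ret_num_eq: "ret_num v (stack_enc K) = conf_enc (ret v K)"
proof (cases K)
  case (Cons F K')
  then show ?thesis by (cases F) (simp_all add: ret_num_def Let_def)
qed (simp add: ret_num_def)

lemma step_num_eq: "step_num N S (conf_enc s) = conf_enc (step N (set_decode S) s)"
  by (cases s) (simp_all add: step_num_def call_num_eq ret_num_eq)

text \<open>Giving the oracle as the code \<open>S\<close> of a finite set turns it into an ordinary
  argument, so that quantifying over all oracles on an initial segment becomes a bounded quantifier
  over numbers.\<close>

definition run_num :: "nat \<Rightarrow> nat \<Rightarrow> nat \<Rightarrow> nat \<Rightarrow> nat" where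
  "run_num N S e x = rec_nat (call_enc e x 0) (\<lambda>_. step_num N S) N"

lemma run_num_eq: "run_num N S e x = conf_enc (run N (set_decode S) e x)"
proof -
  have "rec_nat (call_enc e x 0) (\<lambda>_. step_num N S) t
    = conf_enc ((step N (set_decode S) ^^ t) (start e x))" for t
    by (induction t) (simp_all add: step_num_eq start_def bij_encode bij_is_surj surj_f_inv_f)
  then show ?thesis by (simp add: run_num_def run_def)
qed

lemma unif_div4: "unif f \<Longrightarrow> unif (\<lambda>Y x. f Y x div 4)"
  using unif_div2[OF unif_div2[of f]] by (simp add: div_mult2_eq[symmetric])

lemma unif_call_num:
  assumes "unif N" "unif S" "unif e" "unif y" "unif K"
  shows "unif (\<lambda>Y x. call_num (N Y x) (S Y x) (e Y x) (y Y x) (K Y x))"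
  unfolding call_num_def Let_def by (intro unif_basic unif_div4 assms)

lemma unif_ret_num:
  assumes "unif y" "unif K"
  shows "unif (\<lambda>Y x. ret_num (y Y x) (K Y x))"
  unfolding ret_num_def Let_def by (intro unif_basic assms)

lemma unif_run_num:
  assumes "unif N" "unif S" "unif e" "unif y"
  shows "unif (\<lambda>Y x. run_num (N Y x) (S Y x) (e Y x) (y Y x))"
  unfolding run_num_def step_num_def
  by (intro unif_rec unif_call_num unif_ret_num unif_basic assms
      unif_comp[OF assms(1)] unif_comp[OF assms(2)])

definition halted :: "nat \<Rightarrow> nat set \<Rightarrow> nat \<Rightarrow> nat \<Rightarrow> bool" where
  "halted N Y e x \<longleftrightarrow> (\<exists>v. run N Y e x = Ret v [])"

lemma phi_not_None_iff: "phi Y e x \<noteq> None \<longleftrightarrow> (\<exists>N. halted N Y e x)"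
  unfolding halted_def using phi_eq_Some_iff by auto

lemma halted_mono:
  "halted N Y e x \<Longrightarrow> N \<le> M \<Longrightarrow> Y \<inter> {..<N} = Z \<inter> {..<N} \<Longrightarrow> halted M Z e x"
  unfolding halted_def using run_mono by blast

lemma ret_enc_iff: "z = ret_enc v 0 \<longleftrightarrow> p1 z = 0 \<and> p1 (p2 z) = v \<and> p2 (p2 z) = 0"
  by (metis fst_conv prod.collapse prod_decode_inverse prod_encode_inverse snd_conv)

lemma halted_num: "halted N (set_decode S) e x
  \<longleftrightarrow> p1 (run_num N S e x) = 0 \<and> p2 (p2 (run_num N S e x)) = 0"
proof -
  have "halted N (set_decode S) e x \<longleftrightarrow> (\<exists>v. run_num N S e x = ret_enc v 0)"
    by (simp add: halted_def run_num_eq conf_enc_halted)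
  then show ?thesis by (simp add: ret_enc_iff)
qed

lemma dec_halted:
  assumes "unif N" "unif S" "unif e" "unif y"
  shows "dec (\<lambda>Y x. halted (N Y x) (set_decode (S Y x)) (e Y x) (y Y x))"
  unfolding halted_num by (intro unif_basic unif_run_num assms)

lemma phi_eq_Some_num:
  "phi {} e x = Some v \<longleftrightarrow> (\<exists>N. run_num N 0 e x = ret_enc v 0)"
  by (simp add: phi_eq_Some_iff run_num_eq conf_enc_halted)

text \<open>The total decision program returns 0 exactly on witnesses, so minimisation never meets
  an undefined value. The program is exhibited as a \<open>Mu\<close> because
  \<open>universal_code\<close> later uses that the rank of a \<open>Mu\<close> is its
  result.\<close>

lemma unif_search:
  assumes "dec (\<lambda>Y z. P Y (p1 z) (p2 z))"
  shows "\<exists>c. \<forall>Y x. eval Y (Mu c) x = (if \<exists>n. P Y x n then Some (LEAST n. P Y x n) else None)"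
proof -
  obtain d where d: "\<forall>Y z. eval Y d z = Some (if P Y (p1 z) (p2 z) then 0 else 1)"
    using unif_if[OF assms unif_const[of 0] unif_const[of 1]] unfolding unif_def by blast
  show ?thesis
    by (rule exI[of _ d]) (simp add: d)
qed

lemma unif_encode_const_code:
  assumes "unif f" shows "unif (\<lambda>Y x. encode (const_code (f Y x)))"
proof -
  have "rec_nat 0 (\<lambda>i r. 6 + 4 * prod_encode (1, r)) n = encode (const_code n)" for n
    by (induction n) simp_all
  moreover have "unif (\<lambda>Y x. rec_nat 0 (\<lambda>i r. 6 + 4 * prod_encode (1, r)) (f Y x))"
    by (intro unif_rec unif_basic assms)
  ultimately show ?thesis by simp
qed

lemma unif_encode_simps:
  assumes "unif (\<lambda>Y x. encode (c Y x))" "unif (\<lambda>Y x. encode (d Y x))"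
  shows "unif (\<lambda>Y x. encode (Pair (c Y x) (d Y x)))" "unif (\<lambda>Y x. encode (Comp (c Y x) (d Y x)))"
  unfolding encode.simps by (intro unif_basic assms)+

section \<open>The low basis theorem\<close>

text \<open>Compactness of Cantor space, where \<open>B N S\<close> means that \<open>S\<close> is
  refuted by its part below \<open>N\<close>. Every \<open>N\<close> has an unrefuted
  \<open>\<sigma> N\<close>; the segments \<open>f n\<close>, each shared by infinitely many
  \<open>\<sigma> N\<close>, cohere into \<open>X\<close>.\<close>

lemma koenig:
  fixes B :: "nat \<Rightarrow> nat set \<Rightarrow> bool"
  assumes mono: "\<And>N M S Z. B N S \<Longrightarrow> N \<le> M \<Longrightarrow> S \<inter> {..<N} = Z \<inter> {..<N} \<Longrightarrow> B M Z"
    and ex: "\<And>N. \<exists>S. \<not> B N S"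
  shows "\<exists>X. \<forall>N. \<not> B N X"
proof -
  obtain \<sigma> where \<sigma>: "\<not> B N (\<sigma> N)" for N using ex by metis
  define good where "good n A \<longleftrightarrow> infinite {N. \<sigma> N \<inter> {..<n} = A}" for n A
  have "\<exists>f. \<forall>n. good n (f n) \<and> f (Suc n) \<inter> {..<n} = f n"
  proof (rule dependent_nat_choice)
    show "\<exists>A. good 0 A" by (auto simp: good_def)
  next
    fix A n assume *: "good n A"
    have "{N. \<sigma> N \<inter> {..<n} = A} = (\<Union>A'\<in>{A, insert n A}. {N. \<sigma> N \<inter> {..<n} = A \<and> \<sigma> N \<inter> {..<Suc n} = A'})"
      by (auto simp: lessThan_Suc)
    then have "\<exists>A'\<in>{A, insert n A}. infinite {N. \<sigma> N \<inter> {..<n} = A \<and> \<sigma> N \<inter> {..<Suc n} = A'}"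
      using * unfolding good_def by (metis (no_types, lifting) finite.emptyI finite.insertI finite_UN_I)
    then obtain A' where A': "infinite {N. \<sigma> N \<inter> {..<n} = A \<and> \<sigma> N \<inter> {..<Suc n} = A'}" by blast
    then obtain N where "\<sigma> N \<inter> {..<n} = A" "\<sigma> N \<inter> {..<Suc n} = A'"
      using not_finite_existsD by blast
    then have "A' \<inter> {..<n} = A" by auto
    moreover have "good (Suc n) A'"
      unfolding good_def by (rule infinite_super[OF _ A']) auto
    ultimately show "\<exists>A'. good (Suc n) A' \<and> A' \<inter> {..<n} = A" by blast
  qed
  then obtain f where f: "\<And>n. good n (f n)" "\<And>n. f (Suc n) \<inter> {..<n} = f n" by blast
  define X where "X = {n. n \<in> f (Suc n)}"
  have sub: "f n \<subseteq> {..<n}" for n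
  proof -
    have "{N. \<sigma> N \<inter> {..<n} = f n} \<noteq> {}" using f(1)[of n] unfolding good_def by (metis finite.emptyI)
    then show ?thesis by auto
  qed
  have X: "X \<inter> {..<n} = f n" for n
  proof (induction n)
    case (Suc n)
    have "X \<inter> {..<Suc n} = f n \<union> (X \<inter> {n})" using Suc by (auto simp: lessThan_Suc)
    also have "\<dots> = f (Suc n)" using f(2)[of n] sub[of "Suc n"] by (auto simp: X_def lessThan_Suc)
    finally show ?case .
  qed (use sub[of 0] in auto)
  have "\<not> B N X" for N
  proof
    assume B: "B N X"
    have "infinite {M. \<sigma> M \<inter> {..<N} = f N}" using f(1) by (simp add: good_def)
    \<comment> \<open>Refutations persist, so one of \<open>X\<close> at \<open>N\<close> would also
      refute a later \<open>\<sigma> M\<close> that agrees with \<open>X\<close> below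
      \<open>N\<close>.\<close>
    then obtain M where M: "M \<ge> N" "\<sigma> M \<inter> {..<N} = f N"
      unfolding infinite_nat_iff_unbounded_le by blast
    then have "B M (\<sigma> M)" using mono[OF B M(1)] X by simp
    then show False using \<sigma> by blast
  qed
  then show ?thesis by blast
qed

lemma jump_iff: "e \<in> jump Y \<longleftrightarrow> (\<exists>N. halted N Y e e)"
  using phi_not_None_iff by (simp add: jump_def)

lemma set_encode_less:
  assumes "A \<subseteq> {..<n}" shows "set_encode A < 2 ^ n"
proof -
  have "set_encode A \<le> (\<Sum>i<n. 2 ^ i)"
    unfolding set_encode_def by (rule sum_mono2) (use assms in auto)
  also have "\<dots> < 2 ^ n" by (induction n) auto
  finally show ?thesis .
qed

lemma in_set_decode_less: "e \<in> set_decode n \<Longrightarrow> e < n"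
proof -
  assume "e \<in> set_decode n"
  then have "n div 2 ^ e \<noteq> 0" by (auto simp: set_decode_def intro: ccontr)
  then have "2 ^ e \<le> n" by (metis div_less not_le)
  then show ?thesis using less_exp[of e] by (meson less_le_trans)
qed

text \<open>
  Every \<open>\<Pi>\<^sup>0\<^sub>1\<close> class has the form \<open>{X. i \<notin> jump X}\<close>, where \<open>i\<close> is a
  program that searches for a violation of its defining condition. Hence requiring further programs
  to diverge leads to a class of the same kind, and the construction only asks whether such classes
  are empty.
\<close>

definition omittable :: "nat set \<Rightarrow> bool" where
  "omittable A \<longleftrightarrow> (\<exists>X. A \<inter> jump X = {})"

lemma omittable_iff: "omittable A \<longleftrightarrow> (\<exists>X. \<forall>N. \<not> (\<exists>e\<in>A. halted N X e e))"
  unfolding omittable_def using jump_iff by fast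

text \<open>Compactness again: a decreasing sequence of nonempty effectively closed classes has a
  common member. Letting stage \<open>N\<close> watch only the programs in \<open>F N\<close> makes
  refutation depend on one growing parameter.\<close>

lemma omittable_limit:
  fixes F :: "nat \<Rightarrow> nat set"
  assumes "mono F" "\<And>n. omittable (F n)"
  shows "omittable (\<Union>n. F n)"
proof -
  have "\<exists>X. \<forall>N. \<not> (\<exists>e\<in>F N. halted N X e e)"
  proof (rule koenig)
    show "\<exists>S. \<not> (\<exists>e\<in>F N. halted N S e e)" for N
      using assms(2)[of N] unfolding omittable_iff by blast
  next
    fix N M S Z assume *: "\<exists>e\<in>F N. halted N S e e" "N \<le> M" "S \<inter> {..<N} = Z \<inter> {..<N}"
    then show "\<exists>e\<in>F M. halted M Z e e"
      using halted_mono monoD[OF assms(1) *(2)] by blast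
  qed
  then obtain X where X: "\<not> halted N X e e" if "e \<in> F N" for N e by blast
  have "\<not> halted N X e e" if "e \<in> F M" for N M e
    using X[of e "max N M"] halted_mono[of N X e e "max N M" X] that monoD[OF assms(1), of M "max N M"]
    by auto
  then have "\<forall>N. \<not> (\<exists>e\<in>\<Union>n. F n. halted N X e e)" by blast
  then show ?thesis unfolding omittable_iff by (rule exI)
qed

text \<open>Compactness turns emptiness of the class into an existential statement about numbers: at
  some \<open>N\<close>, every oracle on \<open>{..<N}\<close>, coded below \<open>2 ^ N\<close>,
  already makes a program in \<open>A\<close> halt.\<close>

lemma not_omittable_iff:
  "\<not> omittable A \<longleftrightarrow> (\<exists>N. \<forall>\<sigma><2 ^ N. \<exists>e\<in>A. halted N (set_decode \<sigma>) e e)"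
proof
  assume "\<not> omittable A"
  show "\<exists>N. \<forall>\<sigma><2 ^ N. \<exists>e\<in>A. halted N (set_decode \<sigma>) e e"
  proof (rule ccontr)
    assume contra: "\<not> ?thesis"
    have "\<exists>X. \<forall>N. \<not> (\<exists>e\<in>A. halted N X e e)"
      by (rule koenig) (use contra halted_mono in blast)+
    with \<open>\<not> omittable A\<close> show False unfolding omittable_iff by blast
  qed
next
  assume "\<exists>N. \<forall>\<sigma><2 ^ N. \<exists>e\<in>A. halted N (set_decode \<sigma>) e e"
  then obtain N where N: "\<And>\<sigma>. \<sigma> < 2 ^ N \<Longrightarrow> \<exists>e\<in>A. halted N (set_decode \<sigma>) e e" by blast
  have "\<exists>e\<in>A. e \<in> jump X" for X
  proof -
    obtain e where e: "e \<in> A" "halted N (X \<inter> {..<N}) e e"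
      using N[OF set_encode_less[of "X \<inter> {..<N}"]] by (auto simp: set_encode_inverse)
    then have "halted N X e e" by (auto intro: halted_mono[of N "X \<inter> {..<N}"])
    with e(1) show ?thesis by (auto simp: jump_iff)
  qed
  then show "\<not> omittable A" by (auto simp: omittable_def)
qed

lemma not_omittable_many_one:
  "\<exists>g. unif (\<lambda>Y. g) \<and> (\<forall>n. g n \<in> jump {} \<longleftrightarrow> \<not> omittable (insert i (set_decode n)))"
proof -
  \<comment> \<open>The bound \<open>e < n\<close> holds automatically in
    \<open>set_decode n\<close> and makes the quantifier bounded.\<close>
  define P where "P Y n N \<longleftrightarrow> (\<forall>\<sigma><2 ^ N. halted N (set_decode \<sigma>) i i \<or>
      (\<exists>e<n. e \<in> set_decode n \<and> halted N (set_decode \<sigma>) e e))" for Y :: "nat set" and n N :: nat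
  have P: "(\<exists>N. P Y n N) \<longleftrightarrow> \<not> omittable (insert i (set_decode n))" for Y n
  proof -
    have "(\<exists>e<n. e \<in> set_decode n \<and> H e) \<longleftrightarrow> (\<exists>e\<in>set_decode n. H e)" for H
      using in_set_decode_less by blast
    then show ?thesis unfolding P_def not_omittable_iff by simp
  qed
  have "dec (\<lambda>Y z. P Y (p1 z) (p2 z))"
    unfolding P_def by (intro dec_all_less dec_ex_less dec_halted unif_basic)
  from unif_search[OF this] obtain c where
    c: "\<And>Y x. eval Y c x = (if \<exists>n. P Y x n then Some (LEAST n. P Y x n) else None)"
    by blast
  \<comment> \<open>The program \<open>Comp c (const_code n)\<close> ignores its input, so the
    self-application in the jump asks just whether the search for parameter \<open>n\<close>
    succeeds.\<close>
  have "unif (\<lambda>Y n. encode (Comp c (const_code n)))"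
    by (intro unif_encode_simps unif_encode_const_code unif_basic)
  moreover have "encode (Comp c (const_code n)) \<in> jump {} \<longleftrightarrow> \<not> omittable (insert i (set_decode n))" for n
    unfolding jump_def mem_Collect_eq phi_encode P[of "{}", symmetric] by (simp add: c)
  ultimately show ?thesis by blast
qed

text \<open>Jockusch-Soare forcing of the jump: at stage \<open>e\<close>, divergence of program
  \<open>e\<close> is demanded whenever this leaves the class nonempty. Hence \<open>e\<close>
  enters the jump of the limit \<open>X\<close> exactly when the demand was refused, and
  \<open>jump {}\<close> knows the refusals.\<close>

theorem low_basis:
  assumes "i \<notin> jump X0"
  shows "\<exists>X. i \<notin> jump X \<and> low X"
proof -
  obtain g where g: "unif (\<lambda>Y. g)"
    "\<And>n. g n \<in> jump {} \<longleftrightarrow> \<not> omittable (insert i (set_decode n))"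
    using not_omittable_many_one by blast
  define F where "F = rec_nat {} (\<lambda>e A. if omittable (insert i (insert e A)) then insert e A else A)"
  have F_simps: "F 0 = {}" "F (Suc e) = (if omittable (insert i (insert e (F e))) then insert e (F e) else F e)" for e
    by (simp_all add: F_def)
  have F_sub: "F e \<subseteq> {..<e}" for e
    by (induction e) (auto simp: F_simps)
  then have fin: "finite (F e)" for e by (rule finite_subset) simp
  have nin: "e \<notin> F e" for e using F_sub[of e] by auto
  have om: "omittable (insert i (F e))" for e
    using assms by (induction e) (auto simp: F_simps omittable_def)
  have "mono F" by (auto simp: mono_iff_le_Suc F_simps)
  then have "omittable (\<Union>e. insert i (F e))"
    by (intro omittable_limit om) (auto simp: mono_def)
  then obtain X where X: "i \<notin> jump X" "\<And>e. F e \<inter> jump X = {}"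
    by (auto simp: omittable_def)
  have jump_X: "e \<in> jump X \<longleftrightarrow> \<not> omittable (insert i (insert e (F e)))" for e
  proof
    assume "e \<in> jump X" then show "\<not> omittable (insert i (insert e (F e)))"
      using X(2)[of "Suc e"] by (auto simp: F_simps split: if_splits)
  next
    assume "\<not> omittable (insert i (insert e (F e)))" then show "e \<in> jump X"
      using X by (auto simp: omittable_def)
  qed
  \<comment> \<open>With \<open>Y = jump {}\<close>, \<open>h\<close> retraces the codes of the sets
    \<open>F e\<close> from the oracle's answers. As \<open>e\<close> is not in \<open>F e\<close>,
    adding \<open>2 ^ e\<close> inserts it.\<close>
  define h where "h Y = rec_nat 0 (\<lambda>e n. if g (n + 2 ^ e) \<in> Y then n else n + 2 ^ e)" for Y
  have g': "g (set_encode (F e) + 2 ^ e) \<in> jump {} \<longleftrightarrow> \<not> omittable (insert i (insert e (F e)))" for e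
  proof -
    have "set_decode (set_encode (F e) + 2 ^ e) = insert e (F e)"
      using set_decode_plus_power_2[of e "set_encode (F e)"] fin[of e] nin[of e]
      by (simp add: add.commute)
    then show ?thesis using g(2) by simp
  qed
  have h: "h (jump {}) e = set_encode (F e)" for e
  proof (induction e)
    case (Suc e)
    have "h (jump {}) (Suc e) = (if g (h (jump {}) e + 2 ^ e) \<in> jump {} then h (jump {}) e
        else h (jump {}) e + 2 ^ e)" by (simp add: h_def)
    then show ?case using g'[of e] fin[of e] nin[of e] unfolding Suc.IH
      by (simp add: F_simps set_encode_insert)
  qed (simp add: h_def F_simps)
  have "unif (\<lambda>Y e. if g (h Y e + 2 ^ e) \<in> Y then 1 else 0)"
    unfolding h_def by (intro unif_comp[OF g(1)] unif_rec unif_basic)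
  then obtain c where c: "\<And>Y e. eval Y c e = Some (if g (h Y e + 2 ^ e) \<in> Y then 1 else 0)"
    unfolding unif_def by blast
  have "phi (jump {}) (encode c) e = Some (if e \<in> jump X then 1 else 0)" for e
    by (simp add: c h g' jump_X)
  then have "low X" unfolding low_def turing_le_def computable_in_def by blast
  with X(1) show ?thesis by blast
qed

section \<open>The graph model\<close>

text \<open>\<open>Arr \<beta> b\<close> is a finite piece of a graph: an input containing all of
  \<open>\<beta>\<close> yields \<open>b\<close>. Lists serve as finite sets, since
  \<open>gapp\<close> looks only at \<open>set \<beta>\<close>.\<close>

datatype 'a el = Atom 'a | Arr "'a el list" "'a el"

definition gapp :: "'a el set \<Rightarrow> 'a el set \<Rightarrow> 'a el set" where
  "gapp X Y = {b. \<exists>\<beta>. Arr \<beta> b \<in> X \<and> set \<beta> \<subseteq> Y}"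

lemma gapp_mono: "X \<subseteq> X' \<Longrightarrow> Y \<subseteq> Y' \<Longrightarrow> gapp X Y \<subseteq> gapp X' Y'"
  unfolding gapp_def by blast

text \<open>Continuity of application: finitely many outputs use finitely many elements of function
  and argument.\<close>

lemma gapp_finite:
  assumes "set \<delta> \<subseteq> gapp Y Z"
  shows "\<exists>\<beta> \<gamma>. set \<beta> \<subseteq> Y \<and> set \<gamma> \<subseteq> Z \<and> set \<delta> \<subseteq> gapp (set \<beta>) (set \<gamma>)"
  using assms
proof (induction \<delta>)
  case Nil
  have "set [] \<subseteq> Y \<and> set [] \<subseteq> Z \<and> set [] \<subseteq> gapp (set []) (set [])" by simp
  then show ?case by blast
next
  case (Cons d \<delta>)
  then obtain \<beta> \<gamma> where *: "set \<beta> \<subseteq> Y" "set \<gamma> \<subseteq> Z" "set \<delta> \<subseteq> gapp (set \<beta>) (set \<gamma>)" by auto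
  from Cons.prems obtain \<zeta> where \<zeta>: "Arr \<zeta> d \<in> Y" "set \<zeta> \<subseteq> Z" by (auto simp: gapp_def)
  have "gapp (set \<beta>) (set \<gamma>) \<subseteq> gapp (set (Arr \<zeta> d # \<beta>)) (set (\<zeta> @ \<gamma>))"
    by (rule gapp_mono) auto
  moreover have "d \<in> gapp (set (Arr \<zeta> d # \<beta>)) (set (\<zeta> @ \<gamma>))"
    by (auto simp: gapp_def)
  ultimately have "set (d # \<delta>) \<subseteq> gapp (set (Arr \<zeta> d # \<beta>)) (set (\<zeta> @ \<gamma>))"
    using *(3) by auto
  moreover have "set (Arr \<zeta> d # \<beta>) \<subseteq> Y" "set (\<zeta> @ \<gamma>) \<subseteq> Z" using * \<zeta> by auto
  ultimately show ?case by blast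
qed

definition sapply :: "'a el set \<Rightarrow> 'a el set \<Rightarrow> 'a el set \<Rightarrow> 'a el set" where
  "sapply X Y Z = gapp (gapp X Z) (gapp Y Z)"

lemma sapply_mono: "X \<subseteq> X' \<Longrightarrow> Y \<subseteq> Y' \<Longrightarrow> Z \<subseteq> Z' \<Longrightarrow> sapply X Y Z \<subseteq> sapply X' Y' Z'"
  unfolding sapply_def by (intro gapp_mono)

lemma sapply_finite:
  assumes "c \<in> sapply X Y Z"
  shows "\<exists>\<alpha> \<beta> \<gamma>. set \<alpha> \<subseteq> X \<and> set \<beta> \<subseteq> Y \<and> set \<gamma> \<subseteq> Z \<and> c \<in> sapply (set \<alpha>) (set \<beta>) (set \<gamma>)"
proof -
  from assms obtain \<delta> \<epsilon> where *: "Arr \<epsilon> (Arr \<delta> c) \<in> X" "set \<epsilon> \<subseteq> Z" "set \<delta> \<subseteq> gapp Y Z"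
    by (auto simp: sapply_def gapp_def)
  from gapp_finite[OF *(3)] obtain \<beta> \<gamma> where
    **: "set \<beta> \<subseteq> Y" "set \<gamma> \<subseteq> Z" "set \<delta> \<subseteq> gapp (set \<beta>) (set \<gamma>)" by blast
  \<comment> \<open>The third argument is used twice, by \<open>X\<close> through
    \<open>\<epsilon>\<close> and by \<open>Y\<close> through \<open>\<gamma>\<close>; one list has
    to cover both uses.\<close>
  have "gapp (set \<beta>) (set \<gamma>) \<subseteq> gapp (set \<beta>) (set (\<epsilon> @ \<gamma>))" by (rule gapp_mono) auto
  with **(3) have "set \<delta> \<subseteq> gapp (set \<beta>) (set (\<epsilon> @ \<gamma>))" by blast
  moreover have "Arr \<delta> c \<in> gapp (set [Arr \<epsilon> (Arr \<delta> c)]) (set (\<epsilon> @ \<gamma>))" by (auto simp: gapp_def)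
  ultimately have "c \<in> sapply (set [Arr \<epsilon> (Arr \<delta> c)]) (set \<beta>) (set (\<epsilon> @ \<gamma>))"
    unfolding sapply_def gapp_def[of "gapp _ _" "gapp _ _"] by blast
  moreover have "set [Arr \<epsilon> (Arr \<delta> c)] \<subseteq> X" "set (\<epsilon> @ \<gamma>) \<subseteq> Z" using * ** by auto
  ultimately show ?thesis using **(1) by blast
qed

text \<open>
  The measure \<open>T\<close> makes the unfolding of \<open>sab c\<close> into \<open>ac(bc)\<close> well-founded, without which
  the least fixed point below could miss elements of the representation of \<open>sab c\<close>.
\<close>

locale unique_hnf =
  fixes ap :: "'a \<Rightarrow> 'a \<Rightarrow> 'a option" and T :: "'a \<Rightarrow> 'a \<Rightarrow> nat" and k s :: 'a
    and ka sa :: "'a \<Rightarrow> 'a" and sab :: "'a \<Rightarrow> 'a \<Rightarrow> 'a"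
  assumes ap_k: "ap k a = Some (ka a)" and ap_ka: "ap (ka a) b = Some a"
    and ap_s: "ap s a = Some (sa a)" and ap_sa: "ap (sa a) b = Some (sab a b)"
    and ap_sab: "ap (sab a b) c = Option.bind (ap a c) (\<lambda>u. Option.bind (ap b c) (ap u))"
    and T: "ap a c = Some u \<Longrightarrow> ap b c = Some v \<Longrightarrow> ap u v = Some y
      \<Longrightarrow> T a c < T (sab a b) c \<and> T b c < T (sab a b) c \<and> T u v < T (sab a b) c"
    and inj: "ka a = ka a' \<longleftrightarrow> a = a'" "sa a = sa a' \<longleftrightarrow> a = a'"
      "sab a b = sab a' b' \<longleftrightarrow> a = a' \<and> b = b'"
    and disj: "k \<noteq> s" "k \<noteq> ka a" "k \<noteq> sa a" "k \<noteq> sab a b" "s \<noteq> ka a" "s \<noteq> sa a" "s \<noteq> sab a b"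
      "ka a \<noteq> sa a'" "ka a \<noteq> sab a' b'" "sa a \<noteq> sab a' b'"
begin

definition hnf :: "'a set" where
  "hnf = {k, s} \<union> range ka \<union> range sa \<union> {sab a b | a b. True}"

text \<open>The rules producing \<open>Atom (ka a)\<close>, \<open>Atom (sa a)\<close> and
  \<open>Atom (sab a b)\<close> enlarge the usual graphs of the combinators, so that the application
  of \<open>rep k\<close> to \<open>rep a\<close> also yields the atom of \<open>ka a\<close>, and
  likewise for \<open>s\<close>. The rules for \<open>sa a\<close> and \<open>sab a b\<close> spell
  out membership in \<open>sapply\<close>, which makes the recursive occurrences of
  \<open>mem\<close> visibly positive.\<close>

inductive mem :: "'a \<Rightarrow> 'a el \<Rightarrow> bool" where
  mem_Atom: "mem n (Atom n)"
| "Atom a \<in> set \<beta> \<Longrightarrow> mem k (Arr \<beta> (Atom (ka a)))"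
| "b \<in> set \<beta> \<Longrightarrow> mem k (Arr \<beta> (Arr \<gamma> b))"
| "mem a b \<Longrightarrow> mem (ka a) (Arr \<gamma> b)"
| "Atom a \<in> set \<alpha> \<Longrightarrow> mem s (Arr \<alpha> (Atom (sa a)))"
| "Atom a \<in> set \<alpha> \<Longrightarrow> Atom b \<in> set \<beta> \<Longrightarrow> mem s (Arr \<alpha> (Arr \<beta> (Atom (sab a b))))"
| "c \<in> sapply (set \<alpha>) (set \<beta>) (set \<gamma>) \<Longrightarrow> mem s (Arr \<alpha> (Arr \<beta> (Arr \<gamma> c)))"
| "Atom b \<in> set \<beta> \<Longrightarrow> mem (sa a) (Arr \<beta> (Atom (sab a b)))"
| "mem a (Arr \<epsilon> (Arr \<delta> c)) \<Longrightarrow> set \<epsilon> \<subseteq> set \<gamma> \<Longrightarrow> set \<delta> \<subseteq> gapp (set \<beta>) (set \<gamma>)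
    \<Longrightarrow> mem (sa a) (Arr \<beta> (Arr \<gamma> c))"
| "mem a (Arr \<epsilon> (Arr \<delta> c)) \<Longrightarrow> set \<epsilon> \<subseteq> set \<gamma>
    \<Longrightarrow> \<forall>d\<in>set \<delta>. \<exists>\<zeta>. mem b (Arr \<zeta> d) \<and> set \<zeta> \<subseteq> set \<gamma> \<Longrightarrow> mem (sab a b) (Arr \<gamma> c)"
| "n \<notin> hnf \<Longrightarrow> Atom m \<in> set \<beta> \<Longrightarrow> ap n m = Some y \<Longrightarrow> mem y b \<Longrightarrow> mem n (Arr \<beta> b)"

definition rep :: "'a \<Rightarrow> 'a el set" where "rep n = Collect (mem n)"

lemma hnf_simps [simp]: "k \<in> hnf" "s \<in> hnf" "ka a \<in> hnf" "sa a \<in> hnf" "sab a b \<in> hnf"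
  by (auto simp: hnf_def)

lemmas distinct_simps = inj disj disj[symmetric]

text \<open>Every rule other than \<open>mem_Atom\<close> produces an arrow. The own atom thus
  identifies \<open>n\<close>, which is what keeps the constants apart.\<close>

lemma Atom_in_rep [simp]: "Atom m \<in> rep n \<longleftrightarrow> m = n"
  unfolding rep_def mem_Collect_eq by (subst mem.simps) auto

lemma Arr_in_rep_k: "Arr \<beta> x \<in> rep k
  \<longleftrightarrow> (\<exists>a. Atom a \<in> set \<beta> \<and> x = Atom (ka a)) \<or> (\<exists>\<gamma> b. b \<in> set \<beta> \<and> x = Arr \<gamma> b)"
  unfolding rep_def mem_Collect_eq by (subst mem.simps) (auto simp: distinct_simps)

lemma Arr_in_rep_ka: "Arr \<gamma> x \<in> rep (ka a) \<longleftrightarrow> x \<in> rep a"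
  unfolding rep_def mem_Collect_eq by (subst mem.simps) (auto simp: distinct_simps)

lemma Arr_in_rep_s: "Arr \<alpha> x \<in> rep s
  \<longleftrightarrow> (\<exists>a. Atom a \<in> set \<alpha> \<and> x = Atom (sa a))
    \<or> (\<exists>a b \<beta>. Atom a \<in> set \<alpha> \<and> Atom b \<in> set \<beta> \<and> x = Arr \<beta> (Atom (sab a b)))
    \<or> (\<exists>\<beta> \<gamma> c. c \<in> sapply (set \<alpha>) (set \<beta>) (set \<gamma>) \<and> x = Arr \<beta> (Arr \<gamma> c))"
  unfolding rep_def mem_Collect_eq by (subst mem.simps) (auto simp: distinct_simps)

lemma Arr_in_rep_sa: "Arr \<beta> x \<in> rep (sa a)
  \<longleftrightarrow> (\<exists>b. Atom b \<in> set \<beta> \<and> x = Atom (sab a b))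
    \<or> (\<exists>\<gamma> c. c \<in> sapply (rep a) (set \<beta>) (set \<gamma>) \<and> x = Arr \<gamma> c)"
  \<comment> \<open>The restricted unfolding leaves \<open>gapp (set \<beta>) (set \<gamma>)\<close>
    folded, as in the rule of \<open>mem\<close>.\<close>
  unfolding rep_def mem_Collect_eq sapply_def gapp_def[of "gapp _ _"] gapp_def[of "Collect _"]
  by (subst mem.simps) (auto simp: distinct_simps, blast+)

lemma Arr_in_rep_sab: "Arr \<gamma> x \<in> rep (sab a b) \<longleftrightarrow> x \<in> sapply (rep a) (rep b) (set \<gamma>)"
  unfolding rep_def mem_Collect_eq sapply_def gapp_def subset_iff
  by (subst mem.simps) (auto simp: distinct_simps subset_iff)

lemma Arr_in_rep: "n \<notin> hnf \<Longrightarrow>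
  Arr \<beta> x \<in> rep n \<longleftrightarrow> (\<exists>m y. Atom m \<in> set \<beta> \<and> ap n m = Some y \<and> x \<in> rep y)"
  unfolding rep_def mem_Collect_eq by (subst mem.simps) auto

section \<open>Combinator laws in the graph model\<close>

lemma in_gapp_rep_k: "x \<in> gapp (rep k) X
  \<longleftrightarrow> (\<exists>a. Atom a \<in> X \<and> x = Atom (ka a)) \<or> (\<exists>\<gamma> b. b \<in> X \<and> x = Arr \<gamma> b)" (is "?l \<longleftrightarrow> ?r")
proof
  assume ?l then show ?r unfolding gapp_def mem_Collect_eq Arr_in_rep_k by blast
next
  assume ?r
  then obtain y where "y \<in> X" "Arr [y] x \<in> rep k" unfolding Arr_in_rep_k by auto
  then show ?l unfolding gapp_def by (intro CollectI exI[of _ "[y]"]) simp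
qed

text \<open>The law holds for arbitrary sets, because the additional atoms vanish on the next
  application: \<open>gapp\<close> uses only arrows of its first argument.\<close>

lemma rep_k: "gapp (gapp (rep k) X) Y = X"
proof (intro set_eqI iffI)
  fix x assume "x \<in> gapp (gapp (rep k) X) Y"
  then obtain \<beta> where "Arr \<beta> x \<in> gapp (rep k) X" unfolding gapp_def[of "gapp _ _"] by blast
  then show "x \<in> X" unfolding in_gapp_rep_k by auto
next
  fix x assume "x \<in> X"
  \<comment> \<open>The empty list demands nothing of \<open>Y\<close>, which may be empty.\<close>
  then have "Arr [] x \<in> gapp (rep k) X" unfolding in_gapp_rep_k by blast
  then show "x \<in> gapp (gapp (rep k) X) Y"
    unfolding gapp_def[of "gapp _ _"] by (intro CollectI exI[of _ "[]"]) simp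
qed

text \<open>Passing from the finite lists in \<open>rep s\<close> to an arbitrary \<open>X\<close>
  uses monotonicity in one direction and continuity (\<open>sapply_finite\<close>) in the
  other.\<close>

lemma in_gapp_rep_s: "x \<in> gapp (rep s) X
  \<longleftrightarrow> (\<exists>a. Atom a \<in> X \<and> x = Atom (sa a))
    \<or> (\<exists>a b \<beta>. Atom a \<in> X \<and> Atom b \<in> set \<beta> \<and> x = Arr \<beta> (Atom (sab a b)))
    \<or> (\<exists>\<beta> \<gamma> c. c \<in> sapply X (set \<beta>) (set \<gamma>) \<and> x = Arr \<beta> (Arr \<gamma> c))" (is "?l \<longleftrightarrow> ?r")
proof
  assume ?l
  then obtain \<alpha> where \<alpha>: "Arr \<alpha> x \<in> rep s" "set \<alpha> \<subseteq> X" unfolding gapp_def by blast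
  have "sapply (set \<alpha>) (set \<beta>) (set \<gamma>) \<subseteq> sapply X (set \<beta>) (set \<gamma>)" for \<beta> \<gamma>
    by (intro sapply_mono \<alpha>(2) order_refl)
  with \<alpha> show ?r unfolding Arr_in_rep_s by blast
next
  assume ?r
  then have "\<exists>\<alpha>. Arr \<alpha> x \<in> rep s \<and> set \<alpha> \<subseteq> X"
  proof (elim disjE exE conjE)
    fix a assume "Atom a \<in> X" "x = Atom (sa a)"
    then show ?thesis by (intro exI[of _ "[Atom a]"]) (simp add: Arr_in_rep_s)
  next
    fix a b \<beta> assume "Atom a \<in> X" "Atom b \<in> set \<beta>" "x = Arr \<beta> (Atom (sab a b))"
    then show ?thesis by (intro exI[of _ "[Atom a]"]) (auto simp: Arr_in_rep_s)
  next
    fix \<beta> \<gamma> c assume c: "c \<in> sapply X (set \<beta>) (set \<gamma>)" and x: "x = Arr \<beta> (Arr \<gamma> c)"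
    obtain \<alpha> \<beta>' \<gamma>' where *: "set \<alpha> \<subseteq> X" "set \<beta>' \<subseteq> set \<beta>" "set \<gamma>' \<subseteq> set \<gamma>"
      "c \<in> sapply (set \<alpha>) (set \<beta>') (set \<gamma>')" using sapply_finite[OF c] by blast
    have "sapply (set \<alpha>) (set \<beta>') (set \<gamma>') \<subseteq> sapply (set \<alpha>) (set \<beta>) (set \<gamma>)"
      by (intro sapply_mono * order_refl)
    with * x show ?thesis unfolding Arr_in_rep_s by blast
  qed
  then show ?l unfolding gapp_def by blast
qed

lemma in_gapp_gapp_rep_s: "x \<in> gapp (gapp (rep s) X) Y
  \<longleftrightarrow> (\<exists>a b. Atom a \<in> X \<and> Atom b \<in> Y \<and> x = Atom (sab a b))
    \<or> (\<exists>\<gamma> c. c \<in> sapply X Y (set \<gamma>) \<and> x = Arr \<gamma> c)" (is "?l \<longleftrightarrow> ?r")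
proof
  assume ?l
  then obtain \<beta> where \<beta>: "Arr \<beta> x \<in> gapp (rep s) X" "set \<beta> \<subseteq> Y"
    unfolding gapp_def[of "gapp _ _"] by blast
  have "sapply X (set \<beta>) (set \<gamma>) \<subseteq> sapply X Y (set \<gamma>)" for \<gamma>
    by (intro sapply_mono \<beta>(2) order_refl)
  with \<beta> show ?r unfolding in_gapp_rep_s by blast
next
  assume ?r
  then have "\<exists>\<beta>. Arr \<beta> x \<in> gapp (rep s) X \<and> set \<beta> \<subseteq> Y"
  proof (elim disjE exE conjE)
    fix a b assume "Atom a \<in> X" "Atom b \<in> Y" "x = Atom (sab a b)"
    then show ?thesis by (intro exI[of _ "[Atom b]"]) (auto simp: in_gapp_rep_s)
  next
    fix \<gamma> c assume c: "c \<in> sapply X Y (set \<gamma>)" and x: "x = Arr \<gamma> c"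
    obtain \<alpha> \<beta> \<gamma>' where *: "set \<alpha> \<subseteq> X" "set \<beta> \<subseteq> Y" "set \<gamma>' \<subseteq> set \<gamma>"
      "c \<in> sapply (set \<alpha>) (set \<beta>) (set \<gamma>')" using sapply_finite[OF c] by blast
    have "sapply (set \<alpha>) (set \<beta>) (set \<gamma>') \<subseteq> sapply X (set \<beta>) (set \<gamma>)"
      by (intro sapply_mono * order_refl)
    with * x show ?thesis unfolding in_gapp_rep_s by blast
  qed
  then show ?l unfolding gapp_def[of "gapp _ _"] by blast
qed

lemma Union_sapply: "(\<exists>\<gamma>. set \<gamma> \<subseteq> Z \<and> c \<in> sapply X Y (set \<gamma>)) \<longleftrightarrow> c \<in> sapply X Y Z"
proof
  assume "\<exists>\<gamma>. set \<gamma> \<subseteq> Z \<and> c \<in> sapply X Y (set \<gamma>)"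
  then show "c \<in> sapply X Y Z" using sapply_mono[OF order_refl order_refl] by blast
next
  assume "c \<in> sapply X Y Z"
  then obtain \<alpha> \<beta> \<gamma> where *: "set \<alpha> \<subseteq> X" "set \<beta> \<subseteq> Y" "set \<gamma> \<subseteq> Z"
      "c \<in> sapply (set \<alpha>) (set \<beta>) (set \<gamma>)" using sapply_finite by blast
  have "sapply (set \<alpha>) (set \<beta>) (set \<gamma>) \<subseteq> sapply X Y (set \<gamma>)"
    by (intro sapply_mono * order_refl)
  with * show "\<exists>\<gamma>. set \<gamma> \<subseteq> Z \<and> c \<in> sapply X Y (set \<gamma>)" by blast
qed

lemma rep_s: "gapp (gapp (gapp (rep s) X) Y) Z = gapp (gapp X Z) (gapp Y Z)"
proof -
  have "gapp (gapp (gapp (rep s) X) Y) Z = {c. \<exists>\<gamma>. set \<gamma> \<subseteq> Z \<and> c \<in> sapply X Y (set \<gamma>)}"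
    unfolding gapp_def[of "gapp (gapp (rep s) X) Y"] in_gapp_gapp_rep_s by auto
  then show ?thesis unfolding Union_sapply by (simp add: sapply_def)
qed

lemma rep_ka: "gapp (rep (ka a)) X = rep a"
  unfolding gapp_def Arr_in_rep_ka by (auto intro: exI[of _ "[]"])

lemma gapp_rep_k: "gapp (rep k) (rep a) = rep (ka a)"
proof (rule set_eqI)
  fix x show "x \<in> gapp (rep k) (rep a) \<longleftrightarrow> x \<in> rep (ka a)"
    unfolding in_gapp_rep_k by (cases x) (auto simp: Arr_in_rep_ka)
qed

lemma gapp_rep_s: "gapp (rep s) (rep a) = rep (sa a)"
proof (rule set_eqI)
  fix x show "x \<in> gapp (rep s) (rep a) \<longleftrightarrow> x \<in> rep (sa a)"
    unfolding in_gapp_rep_s by (cases x) (auto simp: Arr_in_rep_sa)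
qed

lemma gapp_rep_sa: "gapp (rep (sa a)) (rep b) = rep (sab a b)"
proof (rule set_eqI)
  fix x show "x \<in> gapp (rep (sa a)) (rep b) \<longleftrightarrow> x \<in> rep (sab a b)"
    unfolding gapp_rep_s[symmetric] in_gapp_gapp_rep_s
    by (cases x) (auto simp: Arr_in_rep_sab)
qed

lemma gapp_rep_sab: "gapp (rep (sab a b)) Z = gapp (gapp (rep a) Z) (gapp (rep b) Z)"
  by (simp only: gapp_rep_sa[symmetric] gapp_rep_s[symmetric] rep_s)

lemma gapp_rep_generic:
  assumes "n \<notin> hnf" "ap n m = Some y" shows "gapp (rep n) (rep m) = rep y"
proof (intro set_eqI iffI)
  fix x assume "x \<in> gapp (rep n) (rep m)"
  then show "x \<in> rep y" using assms unfolding gapp_def Arr_in_rep[OF assms(1)] by auto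
next
  fix x assume "x \<in> rep y"
  then have "Arr [Atom m] x \<in> rep n" unfolding Arr_in_rep[OF assms(1)] using assms(2) by auto
  then show "x \<in> gapp (rep n) (rep m)"
    unfolding gapp_def by (intro CollectI exI[of _ "[Atom m]"]) simp
qed

text \<open>Induction on the measure \<open>T\<close> is needed only for \<open>sab a b\<close>,
  where the law for \<open>s\<close> reduces the claim to the three convergent applications
  \<open>a m\<close>, \<open>b m\<close> and \<open>u v\<close>, all of smaller measure.\<close>

lemma gapp_rep: "ap n m = Some y \<Longrightarrow> gapp (rep n) (rep m) = rep y"
proof (induction "T n m" arbitrary: n m y rule: less_induct)
  case less
  show ?case
  proof (cases "n \<in> hnf")
    case False
    then show ?thesis using less.prems by (rule gapp_rep_generic)
  next
    case True
    then consider "n = k" | "n = s" | a where "n = ka a" | a where "n = sa a"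
      | a b where "n = sab a b" by (auto simp: hnf_def)
    then show ?thesis
    proof cases
      case (5 a b)
      obtain u v where uv: "ap a m = Some u" "ap b m = Some v" "ap u v = Some y"
        using less.prems unfolding 5 ap_sab by (auto split: bind_splits)
      have "T a m < T n m" "T b m < T n m" "T u v < T n m"
        using T[OF uv] 5 by simp_all
      then show ?thesis unfolding 5 gapp_rep_sab using less.hyps uv by (simp add: 5)
    qed (use less.prems in \<open>auto simp: ap_k ap_s ap_ka ap_sa gapp_rep_k gapp_rep_s rep_ka gapp_rep_sa\<close>)
  qed
qed

lemma rep_inj: "rep a = rep b \<longleftrightarrow> a = b"
  by (metis Atom_in_rep)

end

section \<open>Combinators of Kleene's first model\<close>

text \<open>
  A lower bound on halting times. Counting results of minimisation suffices, because the universal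
  program is a minimisation whose result bounds the halting time of the simulated computation. The
  basic operations count 1 only to make this bound strict.
\<close>

primrec rank :: "nat set \<Rightarrow> code \<Rightarrow> nat \<Rightarrow> nat" where
  "rank Y Zero x = 1"
| "rank Y Succ x = 1"
| "rank Y Fst x = 1"
| "rank Y Snd x = 1"
| "rank Y Oracle x = 0"
| "rank Y (Pair c d) x = rank Y c x + (case eval Y c x of None \<Rightarrow> 0 | Some v \<Rightarrow> rank Y d x)"
| "rank Y (Comp c d) x = rank Y d x + (case eval Y d x of None \<Rightarrow> 0 | Some v \<Rightarrow> rank Y c v)"
| "rank Y (Prec c d) x = 0"
| "rank Y (Mu c) x = (case eval Y (Mu c) x of None \<Rightarrow> 0 | Some n \<Rightarrow> n)"

text \<open>The rank still to be accounted for once \<open>v\<close> is returned to the frame. For a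
  failed test of \<open>FMu c x i\<close> it is the distance \<open>n - i\<close> to the final
  result.\<close>

primrec frame_rank :: "nat set \<Rightarrow> frame \<Rightarrow> nat \<Rightarrow> nat" where
  "frame_rank Y (FFst d x) v = rank Y d x"
| "frame_rank Y (FSnd u) v = 0"
| "frame_rank Y (FComp c) v = rank Y c v"
| "frame_rank Y (FPrec d a i) v = 0"
| "frame_rank Y (FMu c x i) v = (if v = 0 then 0
     else case mu_from Y c x (Suc i) of None \<Rightarrow> 0 | Some n \<Rightarrow> n - i)"

primrec stack_rank :: "nat set \<Rightarrow> frame list \<Rightarrow> nat option \<Rightarrow> nat" where
  "stack_rank Y [] r = 0"
| "stack_rank Y (F # K) r = (case r of None \<Rightarrow> 0
     | Some v \<Rightarrow> frame_rank Y F v + stack_rank Y K (frame_sem Y F v))"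

primrec conf_rank :: "nat set \<Rightarrow> conf \<Rightarrow> nat" where
  "conf_rank Y (Call c x K) = rank Y c x + stack_rank Y K (eval Y c x)"
| "conf_rank Y (Ret v K) = stack_rank Y K (Some v)"

lemma stack_rank_None [simp]: "stack_rank Y K None = 0"
  by (cases K) auto

text \<open>A step lowers the rank by at most one: a basic operation uses up its 1, and a failed
  test of a minimisation moves the search one candidate closer to its result.\<close>

lemma conf_rank_step: "conf_rank Y s \<le> Suc (conf_rank Y (step N Y s))"
proof (cases s)
  case (Call c x K)
  show ?thesis
  proof (cases c)
    case (Pair c d)
    then show ?thesis by (simp add: Call split: option.split)
  next
    case (Comp c d)
    then show ?thesis by (simp add: Call split: option.split)
  next
    case (Prec c d)
    have "conf_rank Y s = stack_rank Y K (eval Y (Prec c d) x)"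
      unfolding Call Prec conf_rank.simps rank.simps by (simp del: eval.simps)
    also have "\<dots> \<le> conf_rank Y (step N Y s)"
      unfolding Call Prec conf_rank.simps step.simps call.simps
      by (subst eval_Prec_rec[of Y c d x]) (simp del: eval.simps split: option.split)
    finally show ?thesis by simp
  next
    case (Mu c)
    have "conf_rank Y s = (case mu_from Y c x 0 of None \<Rightarrow> 0 | Some n \<Rightarrow> n)
      + stack_rank Y K (mu_from Y c x 0)"
      unfolding Call Mu conf_rank.simps rank.simps eval_Mu ..
    also have "\<dots> \<le> conf_rank Y (step N Y s)"
      unfolding Call Mu by (subst (1 2) mu_from_rec) (simp split: option.split)
    finally show ?thesis by simp
  qed (simp_all add: Call)
next
  case (Ret v K)
  show ?thesis
  proof (cases K)
    case (Cons F K')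
    show ?thesis
    proof (cases F)
      case (FMu c x i)
      show ?thesis
      proof (cases "v = 0")
        case False
        then have "conf_rank Y s = (case mu_from Y c x (Suc i) of None \<Rightarrow> 0 | Some n \<Rightarrow> n - i)
          + stack_rank Y K' (mu_from Y c x (Suc i))"
          by (simp add: Ret Cons FMu)
        also have "\<dots> \<le> Suc (conf_rank Y (step N Y s))"
          unfolding Ret Cons FMu using False
          by (subst (1 2) mu_from_rec) (auto split: option.split)
        finally show ?thesis .
      qed (simp add: Ret Cons FMu)
    qed (simp_all add: Ret Cons split: option.split)
  qed (simp add: Ret)
qed

lemma rank_le_halting_time:
  assumes "halted N Y e x" shows "rank Y (inv encode e) x \<le> N"
proof -
  have "conf_rank Y s \<le> t + conf_rank Y ((step N Y ^^ t) s)" for t s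
  proof (induction t)
    case (Suc t)
    then show ?case using conf_rank_step[of Y "(step N Y ^^ t) s" N] by simp
  qed simp
  from this[of "start e x" N] show ?thesis
    using assms by (auto simp: halted_def run_def start_def)
qed

text \<open>The program searches for a halting time \<open>N\<close> and then reads off the value.
  Its rank includes \<open>N\<close>, which bounds the rank of the simulated computation, and the
  basic operations in \<open>id_code\<close> make the inequality strict.\<close>

lemma universal_code:
  "\<exists>c. \<forall>e x. eval {} c (prod_encode (e, x)) = phi {} e x
    \<and> (phi {} e x \<noteq> None \<longrightarrow> rank {} (inv encode e) x < rank {} c (prod_encode (e, x)))"
proof -
  define P where "P Y z n \<longleftrightarrow> halted n (set_decode 0) (p1 z) (p2 z)" for Y :: "nat set" and z n
  have "dec (\<lambda>Y z. P Y (p1 z) (p2 z))"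
    unfolding P_def by (intro dec_halted unif_basic)
  from unif_search[OF this] obtain m where
    m: "\<And>Y x. eval Y (Mu m) x = (if \<exists>n. P Y x n then Some (LEAST n. P Y x n) else None)"
    by blast
  define c where "c = Mu m"
  have c: "eval Y c x = (if \<exists>n. P Y x n then Some (LEAST n. P Y x n) else None)"
    and rank_c: "rank Y c x = (case eval Y c x of None \<Rightarrow> 0 | Some n \<Rightarrow> n)" for Y x
    unfolding c_def by (rule m, rule rank.simps)
  have "unif (\<lambda>Y w. p1 (p2 (run_num (p2 w) 0 (p1 (p1 w)) (p2 (p1 w)))))"
    by (intro unif_run_num unif_basic)
  then obtain d where d: "\<forall>Y w. eval Y d w = Some (p1 (p2 (run_num (p2 w) 0 (p1 (p1 w)) (p2 (p1 w)))))"
    unfolding unif_def by blast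
  have "eval {} (Comp d (Pair id_code c)) (prod_encode (e, x)) = phi {} e x
    \<and> (phi {} e x \<noteq> None
      \<longrightarrow> rank {} (inv encode e) x < rank {} (Comp d (Pair id_code c)) (prod_encode (e, x)))" for e x
  proof -
    have P: "P {} (prod_encode (e, x)) = (\<lambda>n. halted n {} e x)"
      by (simp add: P_def fun_eq_iff)
    show ?thesis
    proof (cases "\<exists>n. halted n {} e x")
      case True
      define N where "N = (LEAST n. halted n {} e x)"
      have N: "halted N {} e x" unfolding N_def using True by (rule LeastI_ex)
      then obtain v where "run N {} e x = Ret v []"
        unfolding halted_def by blast
      then have "phi {} e x = Some v" and "run_num N 0 e x = ret_enc v 0"
        by (auto simp: phi_eq_Some_iff run_num_eq)
      moreover have "eval {} c (prod_encode (e, x)) = Some N"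
        using True by (simp add: c P N_def)
      ultimately show ?thesis
        using rank_le_halting_time[OF N] by (simp add: d rank_c id_code_def)
    next
      case False
      then have "phi {} e x = None" using phi_not_None_iff by blast
      with False show ?thesis by (simp add: c P)
    qed
  qed
  then show ?thesis by blast
qed

text \<open>
  The ignored constructor \<open>X\<close> is a tag that keeps the codes of \<open>k\<close>, \<open>s\<close>,
  \<open>ka\<close>, \<open>sa\<close>, \<open>sab\<close> apart.
\<close>

definition wrap :: "code \<Rightarrow> code \<Rightarrow> code" where
  "wrap X c = Comp Fst (Pair c X)"

lemma eval_wrap:
  assumes "X \<in> {Zero, Succ, Fst, Snd, Oracle}"
  shows "eval Y (wrap X c) x = eval Y c x"
  using assms unfolding wrap_def by (cases "eval Y c x") auto

lemma wrap_inject [simp]: "wrap X c = wrap X' c' \<longleftrightarrow> X = X' \<and> c = c'"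
  by (auto simp: wrap_def)

lemma encode_inject [simp]: "encode c = encode d \<longleftrightarrow> c = d"
  using inj_encode by blast

lemma inv_encode [simp]: "inv encode (encode c) = c"
  by (simp add: bij_encode bij_is_inj inv_f_f)

abbreviation curry_code :: "code \<Rightarrow> nat \<Rightarrow> code" where
  "curry_code c a \<equiv> Comp c (Pair (const_code a) id_code)"

theorem K1_unique_hnf: "\<exists>T k s ka sa sab. unique_hnf (phi {}) T k s ka sa sab"
proof -
  obtain U where U: "\<And>e x. eval {} U (prod_encode (e, x)) = phi {} e x"
    and rank_U: "\<And>e x. phi {} e x \<noteq> None
      \<Longrightarrow> rank {} (inv encode e) x < rank {} U (prod_encode (e, x))"
    using universal_code by blast
  \<comment> \<open>The combinators are built from the inside out: \<open>g2\<close> computes codes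
    of \<open>sab a b\<close>, \<open>sa a\<close> is \<open>g2\<close> with \<open>a\<close> fixed,
    and \<open>s\<close> computes codes of \<open>sa a\<close>. The three calls of \<open>U\<close>
    on \<open>(a, c)\<close>, \<open>(b, c)\<close> and \<open>(u, v)\<close> add their ranks, which
    gives the decrease of \<open>T\<close>.\<close>
  define sab where "sab a b = wrap Zero (Comp U (Pair (curry_code U a) (curry_code U b)))" for a b
  have "unif (\<lambda>Y z. encode (sab (p1 z) (p2 z)))"
    unfolding sab_def wrap_def by (intro unif_encode_simps unif_encode_const_code unif_basic)
  then obtain g2 where g2: "\<forall>Y z. eval Y g2 z = Some (encode (sab (p1 z) (p2 z)))"
    unfolding unif_def by blast
  define sa where "sa a = wrap Succ (curry_code g2 a)" for a
  have "unif (\<lambda>Y a. encode (sa a))"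
    unfolding sa_def wrap_def by (intro unif_encode_simps unif_encode_const_code unif_basic)
  then obtain g1 where g1: "\<forall>Y a. eval Y g1 a = Some (encode (sa a))"
    unfolding unif_def by blast
  define ka where "ka a = wrap Snd (const_code a)" for a
  have "unif (\<lambda>Y a. encode (ka a))"
    unfolding ka_def wrap_def by (intro unif_encode_simps unif_encode_const_code unif_basic)
  then obtain g where g: "\<forall>Y a. eval Y g a = Some (encode (ka a))"
    unfolding unif_def by blast
  have "unique_hnf (phi {}) (\<lambda>n. rank {} (inv encode n)) (encode (wrap Oracle g)) (encode (wrap Fst g1))
    (\<lambda>a. encode (ka a)) (\<lambda>a. encode (sa a)) (\<lambda>a b. encode (sab a b))"
  proof
    fix a b c
    show "phi {} (encode (sab a b)) c = Option.bind (phi {} a c) (\<lambda>u. Option.bind (phi {} b c) (phi {} u))"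
      unfolding phi_encode sab_def by (simp add: eval_wrap U bind_eq_comp)
  next
    fix a b c u v y
    assume "phi {} a c = Some u" "phi {} b c = Some v" "phi {} u v = Some y"
    then show "rank {} (inv encode a) c < rank {} (inv encode (encode (sab a b))) c \<and>
       rank {} (inv encode b) c < rank {} (inv encode (encode (sab a b))) c \<and>
       rank {} (inv encode u) v < rank {} (inv encode (encode (sab a b))) c"
      using rank_U[of a c] rank_U[of b c] rank_U[of u v]
      unfolding inv_encode by (simp add: sab_def wrap_def U)
  qed (auto simp: sab_def sa_def ka_def eval_wrap g g1 g2)
  then show ?thesis by blast
qed

section \<open>Congruences on terms\<close>

text \<open>Every number codes exactly one closed term, so quantifying over terms is quantifying
  over numbers.\<close>

definition tm_const :: "nat \<Rightarrow> nat" where "tm_const n = prod_encode (0, n)"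
definition tm_app :: "nat \<Rightarrow> nat \<Rightarrow> nat" where "tm_app a b = prod_encode (Suc a, b)"

function interp :: "(nat \<Rightarrow> 'a el set) \<Rightarrow> nat \<Rightarrow> 'a el set" where
  "interp f x = (case prod_decode x of (0, n) \<Rightarrow> f n | (Suc a, b) \<Rightarrow> gapp (interp f a) (interp f b))"
  by pat_completeness auto
termination
proof (relation "measure snd"; clarsimp)
  fix x a b assume "(Suc a, b) = prod_decode x"
  then have x: "x = prod_encode (Suc a, b)" by (metis prod_decode_inverse)
  show "a < x" unfolding x using le_prod_encode_1[of "Suc a" b] by simp
  show "b < x" unfolding x by (simp add: prod_encode_def)
qed

declare interp.simps [simp del]

lemma interp_tm [simp]: "interp f (tm_const n) = f n" "interp f (tm_app a b) = gapp (interp f a) (interp f b)"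
  unfolding tm_const_def tm_app_def by (subst interp.simps, simp)+

lemma unif_tm:
  "unif f \<Longrightarrow> unif (\<lambda>Y x. tm_const (f Y x))"
  "unif f \<Longrightarrow> unif g \<Longrightarrow> unif (\<lambda>Y x. tm_app (f Y x) (g Y x))"
  unfolding tm_const_def tm_app_def by (intro unif_basic; assumption)+

definition rel :: "nat set \<Rightarrow> nat \<Rightarrow> nat \<Rightarrow> bool" where
  "rel Y a b \<longleftrightarrow> prod_encode (a, b) \<in> Y"

text \<open>
  In the last conjunct \<open>c\<close> bounds the time of the computation of \<open>ab = d\<close> in \<open>K1\<close>, to
  keep the condition decidable in \<open>Y\<close>.
\<close>

definition model_at :: "nat \<Rightarrow> nat \<Rightarrow> nat set \<Rightarrow> nat \<Rightarrow> nat \<Rightarrow> nat \<Rightarrow> nat \<Rightarrow> bool" where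
  "model_at k s Y a b c d \<longleftrightarrow>
     rel Y a a
   \<and> (rel Y a b \<and> rel Y a c \<longrightarrow> rel Y b c)
   \<and> (rel Y a b \<and> rel Y c d \<longrightarrow> rel Y (tm_app a c) (tm_app b d))
   \<and> rel Y (tm_app (tm_app (tm_const k) a) b) a
   \<and> rel Y (tm_app (tm_app (tm_app (tm_const s) a) b) c) (tm_app (tm_app a c) (tm_app b c))
   \<and> (rel Y (tm_const a) (tm_const b) \<longrightarrow> a = b)
   \<and> (run_num c 0 a b = ret_enc d 0 \<longrightarrow> rel Y (tm_app (tm_const a) (tm_const b)) (tm_const d))"

text \<open>The program searches for a coded quadruple violating \<open>model_at\<close> and ignores
  its input, so it halts on its own index exactly when a violation exists.\<close>

lemma model_at_index: "\<exists>i. \<forall>Y. i \<notin> jump Y \<longleftrightarrow> (\<forall>a b c d. model_at k s Y a b c d)"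
proof -
  define P where "P Y z n \<longleftrightarrow> \<not> model_at k s Y (p1 n) (p1 (p2 n)) (p1 (p2 (p2 n))) (p2 (p2 (p2 n)))"
    for Y and z n :: nat
  have dec_rel: "dec (\<lambda>Y x. rel Y (f Y x) (g Y x))" if "unif f" "unif g" for f g
    unfolding rel_def by (intro dec_mem unif_pair that)
  have "dec (\<lambda>Y z. P Y (p1 z) (p2 z))"
    unfolding P_def model_at_def imp_conv_disj
    by (intro dec_rel unif_tm unif_run_num unif_basic)
  from unif_search[OF this] obtain c where
    c: "\<And>Y x. eval Y c x = (if \<exists>n. P Y x n then Some (LEAST n. P Y x n) else None)"
    by blast
  have "encode c \<notin> jump Y \<longleftrightarrow> (\<forall>n. \<not> P Y (encode c) n)" for Y
    by (simp add: jump_def c)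
  moreover have "(\<forall>n. \<not> P Y z n) \<longleftrightarrow> (\<forall>a b c d. model_at k s Y a b c d)" for Y z
  proof
    assume *: "\<forall>n. \<not> P Y z n"
    show "\<forall>a b c d. model_at k s Y a b c d"
    proof (intro allI)
      fix a b c d
      show "model_at k s Y a b c d"
        using *[rule_format, of "prod_encode (a, prod_encode (b, prod_encode (c, d)))"]
        by (simp add: P_def)
    qed
  qed (simp add: P_def)
  ultimately show ?thesis by blast
qed

text \<open>The witness is the kernel of the interpretation of terms in the graph model, with each
  constant \<open>n\<close> sent to \<open>rep n\<close>.\<close>

lemma model_exists:
  assumes "unique_hnf (phi {}) T k s ka sa sab"
  shows "\<exists>Y. \<forall>a b c d. model_at k s Y a b c d"
proof -
  interpret unique_hnf "phi {}" T k s ka sa sab by (rule assms)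
  define Y where "Y = {prod_encode (a, b) | a b. interp rep a = interp rep b}"
  have rel: "rel Y a b \<longleftrightarrow> interp rep a = interp rep b" for a b
    by (auto simp: rel_def Y_def)
  have "model_at k s Y a b c d" for a b c d
  proof -
    have "gapp (rep a) (rep b) = rep d" if "run_num c 0 a b = ret_enc d 0"
      using that by (intro gapp_rep) (auto simp: phi_eq_Some_num)
    then show ?thesis unfolding model_at_def rel by (simp add: rep_k rep_s rep_inj) metis
  qed
  then show ?thesis by blast
qed

text \<open>The algebra is the term algebra modulo \<open>rel Y\<close>. Application of term codes
  is computable outright, and \<open>Y\<close> itself decides equality.\<close>

lemma completion_of_model:
  assumes hnf: "unique_hnf (phi {}) T k s ka sa sab"
    and model: "\<And>a b c d. model_at k s Y a b c d"
  shows "\<exists>A :: nat pas. strong_completion K1 A \<and> computable_algebra Y A"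
proof -
  interpret unique_hnf "phi {}" T k s ka sa sab by (rule hnf)
  note m = model[unfolded model_at_def]
  have refl: "rel Y a a" for a using m by blast
  \<comment> \<open>Together with reflexivity this yields symmetry and transitivity.\<close>
  have eucl: "rel Y b c" if "rel Y a b" "rel Y a c" for a b c using m that by blast
  have cong: "rel Y (tm_app a c) (tm_app b d)" if "rel Y a b" "rel Y c d" for a b c d
    using m that by blast
  have const_inj: "a = b" if "rel Y (tm_const a) (tm_const b)" for a b using m that by blast
  have const_app: "rel Y (tm_app (tm_const a) (tm_const b)) (tm_const v)" if "phi {} a b = Some v" for a b v
    using m that unfolding phi_eq_Some_num by blast
  \<comment> \<open>Least representatives of the classes keep the carrier within the natural
    numbers.\<close>
  define \<gamma> where "\<gamma> n = (LEAST x. rel Y n x)" for n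
  have rel_\<gamma>: "rel Y n (\<gamma> n)" for n unfolding \<gamma>_def by (rule LeastI[OF refl])
  have \<gamma>_eq: "\<gamma> a = \<gamma> b \<longleftrightarrow> rel Y a b" for a b
  proof
    assume "\<gamma> a = \<gamma> b" then show "rel Y a b"
      using rel_\<gamma>[of a] rel_\<gamma>[of b] eucl refl by metis
  next
    assume "rel Y a b"
    then have "rel Y a x \<longleftrightarrow> rel Y b x" for x using eucl refl by metis
    then show "\<gamma> a = \<gamma> b" by (simp add: \<gamma>_def)
  qed
  define A :: "nat pas" where "A = \<lparr>carr = range \<gamma>, app = \<lambda>x y. Some (\<gamma> (tm_app x y))\<rparr>"
  have carr: "carr A = range \<gamma>" by (simp add: A_def)
  have app: "app A (\<gamma> n) (\<gamma> m) = Some (\<gamma> (tm_app n m))" for n m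
  proof -
    have "rel Y (tm_app n m) (tm_app (\<gamma> n) (\<gamma> m))" by (intro cong rel_\<gamma>)
    then show ?thesis by (simp add: A_def \<gamma>_eq[symmetric])
  qed
  have K: "\<gamma> (tm_app (tm_app (tm_const k) a) b) = \<gamma> a" for a b
    unfolding \<gamma>_eq using m by blast
  have S: "\<gamma> (tm_app (tm_app (tm_app (tm_const s) a) b) c) = \<gamma> (tm_app (tm_app a c) (tm_app b c))" for a b c
    unfolding \<gamma>_eq using m by blast
  have comb: "combinators A (\<gamma> (tm_const k)) (\<gamma> (tm_const s))"
    unfolding combinators_def carr by (auto simp: sapp_def app K S)
  have ne: "\<gamma> (tm_const 0) \<noteq> \<gamma> (tm_const 1)"
    unfolding \<gamma>_eq using const_inj[of 0 1] by auto
  have "is_pas A" unfolding is_pas_def by (auto simp: A_def)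
  then have pca: "pca A" unfolding pca_def carr using comb ne by blast
  then have alg: "combinatory_algebra A"
    unfolding combinatory_algebra_def carr by (auto simp: app)
  have comb_K1: "combinators K1 k s"
    unfolding combinators_def by (simp add: K1_def sapp_def ap_k ap_ka ap_s ap_sa ap_sab)
  have "pca K1"
    unfolding pca_def is_pas_def using comb_K1 by (auto simp: K1_def intro: exI[of _ "0::nat"])
  then have "weak_embedding K1 A (\<lambda>n. \<gamma> (tm_const n))"
    unfolding weak_embedding_def using pca const_inj const_app
    by (auto simp: K1_def carr app \<gamma>_eq inj_on_def)
  then have "strong_completion K1 A"
    unfolding strong_completion_def strong_embedding_def using alg comb comb_K1 by blast
  moreover have "computable_algebra Y A"
  proof -
    have "unif (\<lambda>Y z. tm_app (p1 z) (p2 z))" by (intro unif_tm unif_basic)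
    then obtain c where "\<forall>Y z. eval Y c z = Some (tm_app (p1 z) (p2 z))" unfolding unif_def by blast
    then have "\<forall>x y. phi Y (encode c) (prod_encode (x, y)) = Some (tm_app x y)" by simp
    then have "computable2_in Y tm_app" unfolding computable2_in_def by blast
    moreover have "{prod_encode (n, m) | n m. \<gamma> n = \<gamma> m} = Y"
    proof (intro set_eqI)
      fix z
      obtain n m where "z = prod_encode (n, m)" by (metis prod.collapse prod_decode_inverse)
      then show "z \<in> {prod_encode (n, m) | n m. \<gamma> n = \<gamma> m} \<longleftrightarrow> z \<in> Y"
        unfolding \<gamma>_eq rel_def by auto
    qed
    moreover have "\<forall>x. phi Y (encode Oracle) x = Some (if x \<in> Y then 1 else 0)"
      unfolding phi_encode by simp
    then have "Y \<le>\<^sub>T Y" unfolding turing_le_def computable_in_def by blast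
    ultimately show ?thesis
      unfolding computable_algebra_def
      by (intro conjI alg exI[of _ \<gamma>] exI[of _ tm_app]) (simp_all add: carr app)
  qed
  ultimately show ?thesis by blast
qed

theorem theorem5p3:
  shows "\<exists>(Y :: nat set) (A :: nat pas).
    low Y \<and> strong_completion K1 A \<and> computable_algebra Y A"
proof -
  obtain T k s ka sa sab where hnf: "unique_hnf (phi {}) T k s ka sa sab"
    using K1_unique_hnf by blast
  obtain i where i: "\<And>Y. i \<notin> jump Y \<longleftrightarrow> (\<forall>a b c d. model_at k s Y a b c d)"
    using model_at_index by blast
  obtain Y0 where "i \<notin> jump Y0"
    using model_exists[OF hnf] i by blast
  \<comment> \<open>The congruence \<open>Y0\<close> from the graph model only shows that the class
    is nonempty; the low member \<open>Y\<close> may be a different congruence.\<close>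
  then obtain Y where "i \<notin> jump Y" "low Y" using low_basis by blast
  then show ?thesis using completion_of_model[OF hnf] i by blast
qed

end
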